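(* Let $\mathsf{ab}\colon\mathsf{SKB}\to\mathsf{Ab}$ be the reflector from skew braces to abelian groups, and let $f\colon A\to B$ be a homomorphism of skew braces. Assume that $\mathsf{H}_1(f)\colon\mathsf{H}_1(A,\mathsf{ab})\to\mathsf{H}_1(B,\mathsf{ab})$ is an isomorphism and that $\mathsf{H}_2(f)\colon\mathsf{H}_2(A,\mathsf{ab})\to\mathsf{H}_2(B,\mathsf{ab})$ is surjective. Then, for any $n\ge 1$, the morphism $A/A^n\to B/B^n$ induced by $f$ is an isomorphism.
   Context: A skew brace is a triple $(A,+,\circ)$ where $(A,+)$ and $(A,\circ)$ are groups such that $a\circ(b+c)=a\circ b-a+a\circ c$ for all $a,b,c\in A$; $a'$ denotes the inverse of $a$ in $(A,\circ)$. $\mathsf{SKB}$ is the category of skew braces. Put $a*b=-a+a\circ b-b$, $[a,b]_+=a+b-a-b$ and $[a,b]_\circ=a\circ b\circ a'\circ b'$. An ideal of $A$ is a normal subgroup $I$ of $(A,+)$ with $a*x, x*a\in I$ for all $a\in A$, $x\in I$. For an ideal $I$ of $A$, $[I,A]_{\mathsf{Ab}}$ is the subgroup of $(A,+)$ generated by $\{[i,b]_+,\ i*b,\ [i,b]_\circ\mid i\in I,\ b\in A\}$; it is an ideal of $A$. Lower central series: $A^0=A$ and $A^{n+1}=[A^n,A]_{\mathsf{Ab}}$ for $n\ge0$; each $A^n$ is an ideal of $A$. $\mathsf{Ab}$ is identified with the full subcategory of $\mathsf{SKB}$ of skew braces whose two operations coincide and are commutative; the reflector $\mathsf{ab}$,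 left adjoint to the inclusion, is $\mathsf{ab}(A)=A/[A,A]_{\mathsf{Ab}}$. Comonadic homology: let $\mathbb{G}=(G,\epsilon,\delta)$ be the comonad on $\mathsf{SKB}$ induced by the adjunction between the forgetful functor to sets and the free skew brace functor, so $G(B)$ is the free skew brace on the underlying set of $B$ and $\epsilon_B\colon G(B)\to B$ is the canonical surjection. It yields a simplicial object $\mathbb{G}(B)$ with $n$-th term $G^{n+1}(B)$ and faces $d_i=G^{i}(\epsilon_{G^{n-i}(B)})$, $0\le i\le n$. Apply $\mathsf{ab}$ degreewise to get a simplicial abelian group and take its Moore normalization $N$ (the chain complex whose $n$-th term is the intersection of the kernels of all but one extreme face map, with differential the remaining face). Then $\mathsf{H}_n(B,\mathsf{ab})$, $n\ge1$, is the homology of $N(\mathsf{ab}(\mathbb{G}(B)))$ in degree $n-1$ (so that $\mathsf{H}_1(B,\mathsf{ab})\cong\mathsf{ab}(B)$); it is functorial in $B$, and $\mathsf{H}_n(f)$ denotes the map induced by $f$. *)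

theory Defs
  imports "HOL-Algebra.QuotRing" "HOL-Algebra.Generated_Groups"
begin

section \<open>Skew braces\<close>

text \<open>
  A skew brace \<open>(A, +, \<circ>)\<close> is carried by a record of type \<^typ>\<open>'a ring\<close>: the fields \<open>add\<close>, \<open>zero\<close>
  hold the (in general noncommutative) group \<open>(A, +)\<close>, that is \<^term>\<open>add_monoid A\<close>, and the fields
  \<open>mult\<close>, \<open>one\<close> hold the group \<open>(A, \<circ>)\<close>, that is \<open>A\<close> read as a monoid. Only the record type and
  its notation are used, none of the ring axioms: \<open>x \<otimes> y\<close> is \<open>x \<circ> y\<close>, \<open>inv x\<close> is \<open>x'\<close>, and
  \<open>x \<ominus> y\<close> is \<open>x + (- y)\<close>.
\<close>

locale skew_brace =
  fixes A :: "'a ring" (structure)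
  assumes add_is_group: "group (add_monoid A)"
    and circ_is_group: "group A"
    and brace_distrib:
      "\<lbrakk>a \<in> carrier A; b \<in> carrier A; c \<in> carrier A\<rbrakk>
        \<Longrightarrow> a \<otimes> (b \<oplus> c) = (a \<otimes> b \<ominus> a) \<oplus> a \<otimes> c"

definition skb_hom :: "'a ring \<Rightarrow> 'b ring \<Rightarrow> ('a \<Rightarrow> 'b) set"
  where "skb_hom A B = hom (add_monoid A) (add_monoid B) \<inter> hom A B"

definition skb_iso :: "'a ring \<Rightarrow> 'b ring \<Rightarrow> ('a \<Rightarrow> 'b) set"
  where "skb_iso A B = {h \<in> skb_hom A B. bij_betw h (carrier A) (carrier B)}"

definition star :: "'a ring \<Rightarrow> 'a \<Rightarrow> 'a \<Rightarrow> 'a"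
  where "star A a b = (\<ominus>\<^bsub>A\<^esub> a) \<oplus>\<^bsub>A\<^esub> (a \<otimes>\<^bsub>A\<^esub> b) \<ominus>\<^bsub>A\<^esub> b"

definition add_commutator :: "'a ring \<Rightarrow> 'a \<Rightarrow> 'a \<Rightarrow> 'a"
  where "add_commutator A a b = a \<oplus>\<^bsub>A\<^esub> b \<ominus>\<^bsub>A\<^esub> a \<ominus>\<^bsub>A\<^esub> b"

definition circ_commutator :: "'a ring \<Rightarrow> 'a \<Rightarrow> 'a \<Rightarrow> 'a"
  where "circ_commutator A a b = a \<otimes>\<^bsub>A\<^esub> b \<otimes>\<^bsub>A\<^esub> inv\<^bsub>A\<^esub> a \<otimes>\<^bsub>A\<^esub> inv\<^bsub>A\<^esub> b"

text \<open>The ideal \<open>[I, A]\<^sub>A\<^sub>b\<close>, for an ideal \<open>I\<close> of \<open>A\<close>.\<close>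

definition commutator_Ab :: "'a set \<Rightarrow> 'a ring \<Rightarrow> 'a set"
  where "commutator_Ab I A = generate (add_monoid A)
    (\<Union>i\<in>I. \<Union>b\<in>carrier A. {add_commutator A i b, star A i b, circ_commutator A i b})"

primrec lower_central :: "'a ring \<Rightarrow> nat \<Rightarrow> 'a set"
  where
    "lower_central A 0 = carrier A"
  | "lower_central A (Suc n) = commutator_Ab (lower_central A n) A"

text \<open>
  The quotient of a skew brace \<open>A\<close> by an ideal \<open>I\<close> is \<^term>\<open>A Quot I\<close>: its elements are the cosets of
  \<open>I\<close> in \<open>(A, +)\<close>, with the operations induced by those of \<open>A\<close>.

  \<open>coset_map H K f\<close> is the map \<open>G/N \<rightarrow> H/K\<close>, \<open>N + x \<mapsto> K + f x\<close>, induced by a homomorphism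
  \<open>f : G \<rightarrow> H\<close> that sends the normal subgroup \<open>N\<close> of \<open>G\<close> into the normal subgroup \<open>K\<close> of \<open>H\<close>; the sets
  in the union are then all equal.
\<close>

definition coset_map :: "('b, 'm) monoid_scheme \<Rightarrow> 'b set \<Rightarrow> ('a \<Rightarrow> 'b) \<Rightarrow> 'a set \<Rightarrow> 'b set"
  where "coset_map H K f X = (\<Union>x\<in>X. K #>\<^bsub>H\<^esub> f x)"

definition lower_central_quot :: "'a ring \<Rightarrow> nat \<Rightarrow> 'a set ring"
  where "lower_central_quot A n = A Quot lower_central A n"

definition lower_central_quot_map ::
    "'b ring \<Rightarrow> nat \<Rightarrow> ('a \<Rightarrow> 'b) \<Rightarrow> 'a set \<Rightarrow> 'b set"
  where "lower_central_quot_map B n f = coset_map (add_monoid B) (lower_central B n) f"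

definition ab :: "'a ring \<Rightarrow> 'a set ring"
  where "ab A = A Quot commutator_Ab (carrier A) A"

definition ab_map :: "'b ring \<Rightarrow> ('a \<Rightarrow> 'b) \<Rightarrow> 'a set \<Rightarrow> 'b set"
  where "ab_map B f = coset_map (add_monoid B) (commutator_Ab (carrier B) B) f"


section \<open>Free skew braces\<close>

datatype 'a skb_term =
    Gen 'a
  | Zero
  | Add "'a skb_term" "'a skb_term"
  | Neg "'a skb_term"
  | One
  | Circ "'a skb_term" "'a skb_term"
  | Inv "'a skb_term"

definition skb_terms :: "'a set \<Rightarrow> 'a skb_term set"
  where "skb_terms X = {t. set_skb_term t \<subseteq> X}"

text \<open>
  The least congruence on the terms over \<open>X\<close> whose quotient satisfies the skew brace axioms.
\<close>

inductive skb_cong :: "'a set \<Rightarrow> 'a skb_term \<Rightarrow> 'a skb_term \<Rightarrow> bool" for X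
  where
    refl: "s \<in> skb_terms X \<Longrightarrow> skb_cong X s s"
  | sym: "skb_cong X s t \<Longrightarrow> skb_cong X t s"
  | trans: "\<lbrakk>skb_cong X s t; skb_cong X t u\<rbrakk> \<Longrightarrow> skb_cong X s u"
  | Add: "\<lbrakk>skb_cong X s s'; skb_cong X t t'\<rbrakk> \<Longrightarrow> skb_cong X (Add s t) (Add s' t')"
  | Neg: "skb_cong X s s' \<Longrightarrow> skb_cong X (Neg s) (Neg s')"
  | Circ: "\<lbrakk>skb_cong X s s'; skb_cong X t t'\<rbrakk> \<Longrightarrow> skb_cong X (Circ s t) (Circ s' t')"
  | Inv: "skb_cong X s s' \<Longrightarrow> skb_cong X (Inv s) (Inv s')"
  | add_assoc: "\<lbrakk>s \<in> skb_terms X; t \<in> skb_terms X; u \<in> skb_terms X\<rbrakk>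
      \<Longrightarrow> skb_cong X (Add (Add s t) u) (Add s (Add t u))"
  | add_zero: "s \<in> skb_terms X \<Longrightarrow> skb_cong X (Add Zero s) s"
  | add_neg: "s \<in> skb_terms X \<Longrightarrow> skb_cong X (Add (Neg s) s) Zero"
  | circ_assoc: "\<lbrakk>s \<in> skb_terms X; t \<in> skb_terms X; u \<in> skb_terms X\<rbrakk>
      \<Longrightarrow> skb_cong X (Circ (Circ s t) u) (Circ s (Circ t u))"
  | circ_one: "s \<in> skb_terms X \<Longrightarrow> skb_cong X (Circ One s) s"
  | circ_inv: "s \<in> skb_terms X \<Longrightarrow> skb_cong X (Circ (Inv s) s) One"
  | distrib: "\<lbrakk>s \<in> skb_terms X; t \<in> skb_terms X; u \<in> skb_terms X\<rbrakk>
      \<Longrightarrow> skb_cong X (Circ s (Add t u)) (Add (Add (Circ s t) (Neg s)) (Circ s u))"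

definition skb_class :: "'a set \<Rightarrow> 'a skb_term \<Rightarrow> 'a skb_term set"
  where "skb_class X t = {s. skb_cong X t s}"

definition free_skb :: "'a set \<Rightarrow> 'a skb_term set ring"
  where "free_skb X =
    \<lparr>carrier = skb_class X ` skb_terms X,
     mult = (\<lambda>P Q. \<Union>s\<in>P. \<Union>t\<in>Q. skb_class X (Circ s t)),
     one = skb_class X One,
     zero = skb_class X Zero,
     add = (\<lambda>P Q. \<Union>s\<in>P. \<Union>t\<in>Q. skb_class X (Add s t))\<rparr>"

primrec skb_eval :: "'a ring \<Rightarrow> 'a skb_term \<Rightarrow> 'a"
  where
    "skb_eval B (Gen x) = x"
  | "skb_eval B Zero = \<zero>\<^bsub>B\<^esub>"
  | "skb_eval B (Add s t) = skb_eval B s \<oplus>\<^bsub>B\<^esub> skb_eval B t"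
  | "skb_eval B (Neg s) = \<ominus>\<^bsub>B\<^esub> skb_eval B s"
  | "skb_eval B One = \<one>\<^bsub>B\<^esub>"
  | "skb_eval B (Circ s t) = skb_eval B s \<otimes>\<^bsub>B\<^esub> skb_eval B t"
  | "skb_eval B (Inv s) = inv\<^bsub>B\<^esub> skb_eval B s"


section \<open>Comonadic homology in degrees 1 and 2\<close>

text \<open>The functor \<open>G = free_G\<close> and the counit \<open>\<epsilon>\<^sub>B : G B \<rightarrow> B\<close>; the
  argument \<open>B\<close> of \<open>free_G_map\<close> is the codomain.\<close>

definition free_G :: "'a ring \<Rightarrow> 'a skb_term set ring"
  where "free_G B = free_skb (carrier B)"

definition free_G_map :: "'b ring \<Rightarrow> ('a \<Rightarrow> 'b) \<Rightarrow> 'a skb_term set \<Rightarrow> 'b skb_term set"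
  where "free_G_map B f P = (\<Union>t\<in>P. skb_class (carrier B) (map_skb_term f t))"

definition counit :: "'a ring \<Rightarrow> 'a skb_term set \<Rightarrow> 'a"
  where "counit B P = the_elem (skb_eval B ` P)"

text \<open>
  \<open>face\<^sub>n\<^sub>i B : G\<^bsup>n+1\<^esup> B \<rightarrow> G\<^bsup>n\<^esup> B\<close> is \<open>d\<^sub>i = G\<^bsup>i\<^esup>(\<epsilon>)\<close> at \<open>G\<^bsup>n-i\<^esup> B\<close>. The type of \<open>G\<^bsup>n\<^esup> B\<close> depends on \<open>n\<close>, so
  the part of the simplicial object that enters into \<open>H\<^sub>1\<close> and \<open>H\<^sub>2\<close> is written out.
\<close>

definition face10 :: "'a ring \<Rightarrow> 'a skb_term set skb_term set \<Rightarrow> 'a skb_term set"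
  where "face10 B = counit (free_G B)"

definition face11 :: "'a ring \<Rightarrow> 'a skb_term set skb_term set \<Rightarrow> 'a skb_term set"
  where "face11 B = free_G_map B (counit B)"

definition face20 :: "'a ring \<Rightarrow>
    'a skb_term set skb_term set skb_term set \<Rightarrow> 'a skb_term set skb_term set"
  where "face20 B = counit (free_G (free_G B))"

definition face21 :: "'a ring \<Rightarrow>
    'a skb_term set skb_term set skb_term set \<Rightarrow> 'a skb_term set skb_term set"
  where "face21 B = free_G_map (free_G B) (counit (free_G B))"

definition face22 :: "'a ring \<Rightarrow>
    'a skb_term set skb_term set skb_term set \<Rightarrow> 'a skb_term set skb_term set"
  where "face22 B = free_G_map (free_G B) (free_G_map B (counit B))"

text \<open>
  The simplicial abelian group \<open>ab(\<bbbG>(B))\<close> in degrees 0, 1, 2, and its Moore normalization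
  \<open>N\<^sub>n = ker d\<^sub>0 \<inter> \<dots> \<inter> ker d\<^sub>n\<^sub>-\<^sub>1\<close> with differential \<open>d\<^sub>n\<close>; \<open>N\<^sub>0\<close> is the whole degree 0 term.
\<close>

definition chain0 :: "'a ring \<Rightarrow> 'a skb_term set set monoid"
  where "chain0 B = add_monoid (ab (free_G B))"

definition chain1 :: "'a ring \<Rightarrow> 'a skb_term set skb_term set set monoid"
  where "chain1 B = add_monoid (ab (free_G (free_G B)))"

definition chain2 :: "'a ring \<Rightarrow> 'a skb_term set skb_term set skb_term set set monoid"
  where "chain2 B = add_monoid (ab (free_G (free_G (free_G B))))"

definition moore1 :: "'a ring \<Rightarrow> 'a skb_term set skb_term set set set"
  where "moore1 B = kernel (chain1 B) (chain0 B) (ab_map (free_G B) (face10 B))"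

definition moore2 :: "'a ring \<Rightarrow> 'a skb_term set skb_term set skb_term set set set"
  where "moore2 B = kernel (chain2 B) (chain1 B) (ab_map (free_G (free_G B)) (face20 B))
              \<inter> kernel (chain2 B) (chain1 B) (ab_map (free_G (free_G B)) (face21 B))"

definition boundaries0 :: "'a ring \<Rightarrow> 'a skb_term set set set"
  where "boundaries0 B = ab_map (free_G B) (face11 B) ` moore1 B"

definition cycles1 :: "'a ring \<Rightarrow> 'a skb_term set skb_term set set set"
  where "cycles1 B = moore1 B \<inter> kernel (chain1 B) (chain0 B) (ab_map (free_G B) (face11 B))"

definition boundaries1 :: "'a ring \<Rightarrow> 'a skb_term set skb_term set set set"
  where "boundaries1 B = ab_map (free_G (free_G B)) (face22 B) ` moore2 B"

definition homology1 :: "'a ring \<Rightarrow> 'a skb_term set set set monoid"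
  where "homology1 B = chain0 B Mod boundaries0 B"

definition homology2 :: "'a ring \<Rightarrow> 'a skb_term set skb_term set set set monoid"
  where "homology2 B = (chain1 B)\<lparr>carrier := cycles1 B\<rparr> Mod boundaries1 B"

definition homology1_map :: "'b ring \<Rightarrow> ('a \<Rightarrow> 'b) \<Rightarrow>
    'a skb_term set set set \<Rightarrow> 'b skb_term set set set"
  where "homology1_map B f =
    coset_map (chain0 B) (boundaries0 B) (ab_map (free_G B) (free_G_map B f))"

definition homology2_map :: "'b ring \<Rightarrow> ('a \<Rightarrow> 'b) \<Rightarrow>
    'a skb_term set skb_term set set set \<Rightarrow> 'b skb_term set skb_term set set set"
  where "homology2_map B f =
    coset_map (chain1 B) (boundaries1 B)
      (ab_map (free_G (free_G B)) (free_G_map (free_G B) (free_G_map B f)))"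

end

theory Submission
  imports Defs
begin

text \<open>
  This is Stallings' argument, made free of the five-term exact sequence. Write \<open>F\<^sub>A = G(A)\<close>, and \<open>\<epsilon>\<close> for
  the counit. An ideal \<open>I\<close> annihilates \<open>A/[I,A]\<close>, so two homomorphisms \<open>C \<rightarrow> A\<close> that agree modulo
  \<open>I\<close> agree on \<open>[C,C]\<close> modulo \<open>[I,A]\<close>.

  Surjectivity on \<open>H\<^sub>1\<close> propagates along the lower central series by itself. For injectivity, let
  \<open>x \<in> A\<^sup>n\<close> with \<open>f x \<in> B\<^bsup>n+1\<^esup>\<close>, let \<open>S\<^sub>A\<close>, \<open>S\<^sub>B\<close> be the preimages of \<open>A\<^sup>n\<close>, \<open>B\<^sup>n\<close> in \<open>F\<^sub>A\<close>, \<open>F\<^sub>B\<close>, and lift \<open>x\<close> to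
  \<open>r \<in> [F\<^sub>A,F\<^sub>A]\<close> and \<open>f x\<close> to \<open>s \<in> [S\<^sub>B,F\<^sub>B]\<close>. Then \<open>G(f) r - s\<close> lies in \<open>ker \<epsilon> \<inter> [F\<^sub>B,F\<^sub>B]\<close>, and
  surjectivity on \<open>H\<^sub>2\<close> provides \<open>t \<in> ker \<epsilon> \<inter> [F\<^sub>A,F\<^sub>A]\<close> with \<open>G(f) t\<close> congruent to it modulo \<open>[ker \<epsilon>, F\<^sub>B]\<close>.
  Since \<open>A/A\<^sup>n \<cong> B/B\<^sup>n\<close> by induction, there is a map \<open>g : F\<^sub>B \<rightarrow> F\<^sub>A\<close> over this quotient; by the remark
  above, \<open>g \<circ> G(f)\<close> is the identity on \<open>[F\<^sub>A,F\<^sub>A]\<close> modulo \<open>[S\<^sub>A,F\<^sub>A]\<close>, so \<open>r - t \<in> [S\<^sub>A,F\<^sub>A]\<close> and \<open>x \<in> A\<^bsup>n+1\<^esup>\<close>.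
\<close>

section \<open>Elementary arithmetic in skew braces\<close>

text \<open>The rewrites translate the imported group facts from \<open>add_monoid A\<close> into
  the notation of \<open>A\<close>, so that they apply to terms in \<open>\<oplus>\<close> and
  \<open>\<zero>\<close>.\<close>

sublocale skew_brace \<subseteq> add: group "add_monoid A"
  rewrites "carrier (add_monoid A) = carrier A"
    and "mult (add_monoid A) = add A"
    and "one (add_monoid A) = zero A"
    and "m_inv (add_monoid A) = a_inv A"
  by (rule add_is_group) (auto simp: a_inv_def)

sublocale skew_brace \<subseteq> circ: group A
  by (rule circ_is_group)

definition skb_ideal :: "'a set \<Rightarrow> 'a ring \<Rightarrow> bool"
  where "skb_ideal I A \<longleftrightarrow> I \<lhd> add_monoid A \<and>
    (\<forall>a\<in>carrier A. \<forall>x\<in>I. star A a x \<in> I \<and> star A x a \<in> I)"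

context skew_brace
begin

lemma minus_closed [simp]: "\<lbrakk>a \<in> carrier A; b \<in> carrier A\<rbrakk> \<Longrightarrow> a \<ominus> b \<in> carrier A"
  by (simp add: a_minus_def)

lemma star_closed [simp]: "\<lbrakk>a \<in> carrier A; b \<in> carrier A\<rbrakk> \<Longrightarrow> star A a b \<in> carrier A"
  by (simp add: star_def)

lemma add_commutator_closed [simp]:
  "\<lbrakk>a \<in> carrier A; b \<in> carrier A\<rbrakk> \<Longrightarrow> add_commutator A a b \<in> carrier A"
  by (simp add: add_commutator_def)

lemma circ_commutator_closed [simp]:
  "\<lbrakk>a \<in> carrier A; b \<in> carrier A\<rbrakk> \<Longrightarrow> circ_commutator A a b \<in> carrier A"
  by (simp add: circ_commutator_def)

lemma add_cancel [simp]:
  assumes "a \<in> carrier A" "b \<in> carrier A"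
  shows "a \<oplus> (\<ominus> a \<oplus> b) = b" "\<ominus> a \<oplus> (a \<oplus> b) = b" "a \<oplus> b \<oplus> \<ominus> b = a" "a \<oplus> \<ominus> b \<oplus> b = a"
  using assms by (simp_all add: add.m_assoc [symmetric]) (simp_all add: add.m_assoc)

lemma circ_cancel [simp]:
  assumes "a \<in> carrier A" "b \<in> carrier A"
  shows "a \<otimes> (inv a \<otimes> b) = b" "inv a \<otimes> (a \<otimes> b) = b" "a \<otimes> b \<otimes> inv b = a" "a \<otimes> inv b \<otimes> b = a"
  using assms by (simp_all add: circ.m_assoc [symmetric]) (simp_all add: circ.m_assoc)

text \<open>Distributivity at a = 1, b = c = 0 reduces to 0 = -1.\<close>

lemma one_eq_zero [simp]: "\<one> = \<zero>"
proof -
  have "\<one> \<otimes> (\<zero> \<oplus> \<zero>) = \<one> \<otimes> \<zero> \<ominus> \<one> \<oplus> \<one> \<otimes> \<zero>"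
    by (rule brace_distrib) auto
  then have "\<ominus> \<one> = \<zero>"
    by (simp add: a_minus_def)
  then show ?thesis
    by (metis add.inv_inv add.inv_one circ.one_closed)
qed

lemma circ_zero [simp]:
  assumes "a \<in> carrier A" shows "a \<otimes> \<zero> = a" "\<zero> \<otimes> a = a"
  using assms circ.r_one circ.l_one by simp_all

lemma circ_inverse [simp]:
  assumes "a \<in> carrier A" shows "a \<otimes> inv a = \<zero>" "inv a \<otimes> a = \<zero>"
  using assms circ.r_inv circ.l_inv by simp_all

lemma circ_eq_star:
  "\<lbrakk>a \<in> carrier A; b \<in> carrier A\<rbrakk> \<Longrightarrow> a \<otimes> b = a \<oplus> star A a b \<oplus> b"
  by (simp add: star_def a_minus_def add.m_assoc)

text \<open>Since a' is expressed through + and star, an additive subgroup that absorbs star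
  products is also closed under circle inverses.\<close>

lemma circ_inv_eq:
  assumes "a \<in> carrier A" shows "inv a = \<ominus> (a \<oplus> star A a (inv a))"
proof -
  have "\<zero> = a \<oplus> star A a (inv a) \<oplus> inv a"
    using assms circ_eq_star [of a "inv a"] by simp
  then show ?thesis
    using assms add.inv_equality
    by (metis add.inv_inv add.m_closed circ.inv_closed star_closed)
qed

end

text \<open>The lambda map of skew brace theory, the action of (A, \<circ>) on (A, +) by
  automorphisms. It converts sums into circle products and back.\<close>

definition skb_lambda :: "'a ring \<Rightarrow> 'a \<Rightarrow> 'a \<Rightarrow> 'a"
  where "skb_lambda A a b = \<ominus>\<^bsub>A\<^esub> a \<oplus>\<^bsub>A\<^esub> a \<otimes>\<^bsub>A\<^esub> b"

context skew_brace
begin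

lemma lambda_closed [simp]:
  "\<lbrakk>a \<in> carrier A; b \<in> carrier A\<rbrakk> \<Longrightarrow> skb_lambda A a b \<in> carrier A"
  by (simp add: skb_lambda_def)

lemma circ_eq_lambda:
  "\<lbrakk>a \<in> carrier A; b \<in> carrier A\<rbrakk> \<Longrightarrow> a \<otimes> b = a \<oplus> skb_lambda A a b"
  by (simp add: skb_lambda_def)

lemma lambda_eq_star:
  "\<lbrakk>a \<in> carrier A; b \<in> carrier A\<rbrakk> \<Longrightarrow> skb_lambda A a b = star A a b \<oplus> b"
  by (simp add: skb_lambda_def star_def a_minus_def add.m_assoc)

lemma circ_add:
  "\<lbrakk>a \<in> carrier A; b \<in> carrier A; c \<in> carrier A\<rbrakk>
    \<Longrightarrow> a \<otimes> (b \<oplus> c) = a \<otimes> b \<oplus> skb_lambda A a c"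
  by (simp add: skb_lambda_def brace_distrib a_minus_def add.m_assoc)

text \<open>The element a \<circ> (a' + \<lambda>_{a'} b) is computed twice: its second factor is a'
  \<circ> b, which gives b, and distributing gives a \<circ> a' + \<lambda>_a \<lambda>_{a'}
  b.\<close>

lemma lambda_inv_lambda [simp]:
  assumes "a \<in> carrier A" "b \<in> carrier A"
  shows "skb_lambda A a (skb_lambda A (inv a) b) = b"
proof -
  let ?l = "skb_lambda A (inv a) b"
  have "a \<otimes> (inv a \<oplus> ?l) = b"
    using assms by (simp flip: circ_eq_lambda)
  moreover have "a \<otimes> (inv a \<oplus> ?l) = skb_lambda A a ?l"
    using assms by (simp add: circ_add)
  ultimately show ?thesis by simp
qed

lemma add_eq_circ_lambda:
  "\<lbrakk>a \<in> carrier A; b \<in> carrier A\<rbrakk> \<Longrightarrow> a \<oplus> b = a \<otimes> skb_lambda A (inv a) b"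
  by (simp add: circ_eq_lambda)

end

section \<open>Ideals and quotients\<close>

locale skew_brace_ideal = skew_brace A for I :: "'a set" and A :: "'a ring" (structure) +
  assumes ideal: "skb_ideal I A"
begin

sublocale I: normal I "add_monoid A"
  rewrites "carrier (add_monoid A) = carrier A"
    and "mult (add_monoid A) = add A"
    and "one (add_monoid A) = zero A"
    and "m_inv (add_monoid A) = a_inv A"
  using ideal by (auto simp: skb_ideal_def a_inv_def)

lemma sub_carrier: "x \<in> I \<Longrightarrow> x \<in> carrier A"
  using I.subset by auto

lemma star_mem:
  assumes "a \<in> carrier A" "x \<in> I" shows "star A a x \<in> I" "star A x a \<in> I"
  using ideal assms by (auto simp: skb_ideal_def)

lemma lambda_mem: "\<lbrakk>a \<in> carrier A; x \<in> I\<rbrakk> \<Longrightarrow> skb_lambda A a x \<in> I"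
  by (simp add: lambda_eq_star sub_carrier star_mem)

section \<open>Congruence modulo an ideal\<close>

lemma add_swap:
  assumes "x \<in> I" "a \<in> carrier A"
  obtains y where "y \<in> I" "x \<oplus> a = a \<oplus> y"
proof
  show "\<ominus> a \<oplus> x \<oplus> a \<in> I" using assms I.inv_op_closed1 by simp
  show "x \<oplus> a = a \<oplus> (\<ominus> a \<oplus> x \<oplus> a)"
    using assms by (simp add: add.m_assoc sub_carrier)
qed

text \<open>x \<circ> a is (x + star x a) + a, whose bracket lies in I; normality then moves the
  bracket to the right of a.\<close>

lemma circ_swap:
  assumes "x \<in> I" "a \<in> carrier A"
  obtains y where "y \<in> I" "x \<otimes> a = a \<oplus> y"
proof -
  have "x \<otimes> a = (x \<oplus> star A x a) \<oplus> a"
    using assms by (simp add: circ_eq_star sub_carrier)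
  moreover have "x \<oplus> star A x a \<in> I" using assms by (simp add: star_mem)
  ultimately show thesis using add_swap assms that by metis
qed

lemma coset_eq_iff:
  assumes "a \<in> carrier A" "b \<in> carrier A"
  shows "I +> a = I +> b \<longleftrightarrow> (\<exists>x\<in>I. b = x \<oplus> a)"
proof
  assume "I +> a = I +> b"
  moreover have "b \<in> I +> b"
    using assms I.subgroup_axioms add.rcos_self by (simp add: a_r_coset_def)
  ultimately have "b \<in> I +> a" by simp
  then show "\<exists>x\<in>I. b = x \<oplus> a"
    by (auto simp: a_r_coset_def')
next
  assume "\<exists>x\<in>I. b = x \<oplus> a"
  then have "b \<in> I +> a" by (auto simp: a_r_coset_def')
  then show "I +> a = I +> b"
    using assms I.subgroup_axioms add.repr_independence by (simp add: a_r_coset_def)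
qed

lemma coset_eq_iff_right:
  assumes "a \<in> carrier A" "b \<in> carrier A"
  shows "I +> a = I +> b \<longleftrightarrow> (\<exists>x\<in>I. b = a \<oplus> x)"
proof -
  have "a \<oplus> x = (a \<oplus> x \<oplus> \<ominus> a) \<oplus> a \<and> (a \<oplus> x \<oplus> \<ominus> a) \<in> I" if "x \<in> I" for x
    using that assms I.inv_op_closed2 by (simp add: add.m_assoc sub_carrier)
  then show ?thesis
    by (metis add_swap assms coset_eq_iff)
qed

lemma coset_eq_zero_iff: "a \<in> carrier A \<Longrightarrow> I +> a = I +> \<zero> \<longleftrightarrow> a \<in> I"
  by (subst eq_commute) (auto simp: coset_eq_iff sub_carrier)

text \<open>With b = a + x and d = c + y, both error terms can be carried to the right end of the
  product: y by the lambda map of b, and x after it has become a circle factor next to a.\<close>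

lemma coset_circ:
  assumes "a \<in> carrier A" "b \<in> carrier A" "c \<in> carrier A" "d \<in> carrier A"
    and "I +> a = I +> b" "I +> c = I +> d"
  shows "I +> a \<otimes> c = I +> b \<otimes> d"
proof -
  from assms obtain x y where xy: "x \<in> I" "b = a \<oplus> x" "y \<in> I" "d = c \<oplus> y"
    by (auto simp: coset_eq_iff_right)
  \<comment> \<open>This choice gives a + x = a \<circ> ?x, so that the error can be swapped past c
    before it leaves the product.\<close>
  let ?x = "skb_lambda A (inv a) x"
  obtain z where z: "z \<in> I" "?x \<otimes> c = c \<oplus> z"
    using circ_swap [of ?x c] assms xy by (auto simp: lambda_mem)
  have "b \<otimes> d = b \<otimes> c \<oplus> skb_lambda A b y"
    using xy assms by (simp add: circ_add sub_carrier)
  also have "b \<otimes> c = a \<otimes> (?x \<otimes> c)"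
    using xy assms by (simp add: add_eq_circ_lambda sub_carrier circ.m_assoc)
  also have "\<dots> = a \<otimes> c \<oplus> skb_lambda A a z"
    using z assms by (simp add: circ_add sub_carrier)
  finally have "b \<otimes> d = a \<otimes> c \<oplus> (skb_lambda A a z \<oplus> skb_lambda A b y)"
    using z xy assms by (simp add: sub_carrier add.m_assoc)
  moreover have "skb_lambda A a z \<oplus> skb_lambda A b y \<in> I"
    using z xy assms by (simp add: lambda_mem sub_carrier)
  ultimately show ?thesis
    using assms by (auto simp: coset_eq_iff_right)
qed

text \<open>Modulo I the element x may be replaced by 0, and a \<circ> 0 \<circ> a' = 0.\<close>

lemma circ_conj_mem:
  assumes "x \<in> I" "a \<in> carrier A" shows "a \<otimes> x \<otimes> inv a \<in> I"
proof -
  have "I +> a \<otimes> x \<otimes> inv a = I +> a \<otimes> \<zero> \<otimes> inv a"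
    using assms by (intro coset_circ) (auto simp: sub_carrier coset_eq_zero_iff)
  then show ?thesis
    using assms by (simp add: coset_eq_zero_iff sub_carrier)
qed

lemma circ_mem: "\<lbrakk>x \<in> I; y \<in> I\<rbrakk> \<Longrightarrow> x \<otimes> y \<in> I"
  by (simp add: circ_eq_star sub_carrier star_mem)

lemma circ_inv_mem:
  assumes "x \<in> I" shows "inv x \<in> I"
proof (subst circ_inv_eq)
  show "\<ominus> (x \<oplus> star A x (inv x)) \<in> I"
    using assms by (simp add: star_mem sub_carrier)
qed (simp add: assms sub_carrier)

lemma add_commutator_mem:
  assumes "x \<in> I" "a \<in> carrier A" shows "add_commutator A x a \<in> I"
proof -
  have "add_commutator A x a = x \<oplus> (a \<oplus> \<ominus> x \<oplus> \<ominus> a)"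
    using assms by (simp add: add_commutator_def a_minus_def add.m_assoc sub_carrier)
  then show ?thesis using assms I.inv_op_closed2 by simp
qed

lemma circ_commutator_mem:
  assumes "x \<in> I" "a \<in> carrier A" shows "circ_commutator A x a \<in> I"
proof -
  have "circ_commutator A x a = x \<otimes> (a \<otimes> inv x \<otimes> inv a)"
    using assms by (simp add: circ_commutator_def circ.m_assoc sub_carrier)
  then show ?thesis using assms by (simp add: circ_conj_mem circ_inv_mem circ_mem)
qed

section \<open>The commutator ideal [I, A]\<close>

lemma generators_sub:
  "(\<Union>i\<in>I. \<Union>b\<in>carrier A. {add_commutator A i b, star A i b, circ_commutator A i b}) \<subseteq> I"
  by (auto simp: add_commutator_mem star_mem circ_commutator_mem)

lemma commutator_sub: "commutator_Ab I A \<subseteq> I"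
  unfolding commutator_Ab_def
  by (rule add.generate_subgroup_incl [OF generators_sub I.subgroup_axioms])

lemma commutator_gen:
  assumes "x \<in> I" "a \<in> carrier A"
  shows "add_commutator A x a \<in> commutator_Ab I A" "star A x a \<in> commutator_Ab I A"
    "circ_commutator A x a \<in> commutator_Ab I A"
  unfolding commutator_Ab_def using assms by (blast intro: generate.incl)+

lemma commutator_subgroup: "subgroup (commutator_Ab I A) (add_monoid A)"
  unfolding commutator_Ab_def using generators_sub I.subset
  by (intro group.generate_is_subgroup [OF add_is_group]) auto

text \<open>As K lies in I, the three operations applied to k in K and a in A give generators of K
  again. Conjugates are read off from a + k - a = -[k,a] + k. The product star a k, in which k
  stands on the other side, is reached through the circle commutator.\<close>

lemma commutator_ideal: "skb_ideal (commutator_Ab I A) A"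
proof -
  define K where "K = commutator_Ab I A"
  interpret K: subgroup K "add_monoid A"
    rewrites "carrier (add_monoid A) = carrier A"
      and "mult (add_monoid A) = add A"
      and "one (add_monoid A) = zero A"
      and "m_inv (add_monoid A) = a_inv A"
    using commutator_subgroup by (simp_all add: K_def a_inv_def)
  note [simp] = sub_carrier
  have KI: "k \<in> I" "k \<in> carrier A" if "k \<in> K" for k
    using that commutator_sub K.subset by (auto simp: K_def)
  have gen: "add_commutator A x a \<in> K" "star A x a \<in> K" "circ_commutator A x a \<in> K"
    if "x \<in> I" "a \<in> carrier A" for x a
    using commutator_gen that by (auto simp: K_def)
  have circ_mem: "k \<otimes> l \<in> K" if "k \<in> K" "l \<in> K" for k l
    using that KI gen by (simp add: circ_eq_star)
  have conj: "a \<oplus> k \<oplus> \<ominus> a \<in> K" if "k \<in> K" "a \<in> carrier A" for a k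
  proof -
    have "a \<oplus> k \<oplus> \<ominus> a = \<ominus> add_commutator A k a \<oplus> k"
      using that KI by (simp add: add_commutator_def a_minus_def add.inv_mult_group add.m_assoc)
    then show ?thesis using that gen KI by simp
  qed
  have inv_mem: "inv k \<in> K" if "k \<in> K" for k
  proof (subst circ_inv_eq)
    show "\<ominus> (k \<oplus> star A k (inv k)) \<in> K"
      using that gen KI by simp
  qed (simp add: that KI)
  have normal: "K \<lhd> add_monoid A"
    unfolding add.normal_inv_iff using K.subgroup_axioms conj by auto
  have left: "star A a k \<in> K" if "k \<in> K" "a \<in> carrier A" for a k
  proof -
    \<comment> \<open>This is a \<circ> k \<circ> a', written so that its membership in K is
      visible. It turns a \<circ> k into m \<circ> a, where star m a is a generator.\<close>
    define m where "m = inv (circ_commutator A k a) \<otimes> k"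
    have m: "m \<in> K" unfolding m_def using that gen KI by (intro circ_mem inv_mem) auto
    have "a \<otimes> k = m \<otimes> a"
      using that KI
      by (simp add: m_def circ_commutator_def circ.inv_mult_group circ.m_assoc)
    also have "\<dots> = m \<oplus> star A m a \<oplus> a"
      using that KI m by (intro circ_eq_star) auto
    finally have "star A a k = \<ominus> a \<oplus> (m \<oplus> star A m a) \<oplus> \<ominus> (\<ominus> a) \<oplus> \<ominus> k"
      using that KI m by (simp add: star_def [of A a k] a_minus_def add.m_assoc)
    also have "\<dots> \<in> K"
      using that KI m gen by (intro K.m_closed conj) auto
    finally show ?thesis .
  qed
  show ?thesis
    unfolding skb_ideal_def K_def [symmetric] using normal left gen KI by auto
qed

section \<open>The quotient skew brace\<close>

lemma quot_carrier: "carrier (A Quot I) = (\<lambda>x. I +> x) ` carrier A"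
  by (auto simp: FactRing_def A_RCOSETS_def RCOSETS_def a_r_coset_def)

lemma coset_closed [simp]: "x \<in> carrier A \<Longrightarrow> I +> x \<in> carrier (A Quot I)"
  by (simp add: quot_carrier)

lemma quot_zero: "\<zero>\<^bsub>A Quot I\<^esub> = I +> \<zero>"
  using I.subgroup_axioms add.coset_join2 [of \<zero> I] by (simp add: FactRing_def a_r_coset_def)

lemma quot_one: "\<one>\<^bsub>A Quot I\<^esub> = I +> \<zero>"
  by (simp add: FactRing_def)

lemma quot_add:
  assumes "x \<in> carrier A" "y \<in> carrier A"
  shows "(I +> x) \<oplus>\<^bsub>A Quot I\<^esub> (I +> y) = I +> x \<oplus> y"
  using assms I.rcos_sum [of x y] by (simp add: FactRing_def set_add_def a_r_coset_def)

lemma coset_self: "x \<in> carrier A \<Longrightarrow> x \<in> I +> x"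
  using I.subgroup_axioms add.rcos_self by (simp add: a_r_coset_def)

lemma coset_mem:
  assumes "x \<in> carrier A" "y \<in> I +> x" shows "y \<in> carrier A" "I +> y = I +> x"
proof -
  obtain i where "i \<in> I" "y = i \<oplus> x" using assms by (auto simp: a_r_coset_def')
  moreover from this show "y \<in> carrier A" using assms by (simp add: sub_carrier)
  ultimately show "I +> y = I +> x" using assms by (metis coset_eq_iff)
qed

text \<open>In \<open>Quot\<close> the product is a union over all pairs of representatives; by
  \<open>coset_circ\<close> its members are one and the same coset.\<close>

lemma quot_circ:
  assumes "x \<in> carrier A" "y \<in> carrier A"
  shows "(I +> x) \<otimes>\<^bsub>A Quot I\<^esub> (I +> y) = I +> x \<otimes> y"
proof -
  have "I +> x' \<otimes> y' = I +> x \<otimes> y" if "x' \<in> I +> x" "y' \<in> I +> y" for x' y'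
    using assms coset_mem [OF assms(1) that(1)] coset_mem [OF assms(2) that(2)]
    by (intro coset_circ) simp_all
  then have "(\<Union>a\<in>I +> x. \<Union>b\<in>I +> y. I +> a \<otimes> b) = (\<Union>a\<in>I +> x. \<Union>b\<in>I +> y. I +> x \<otimes> y)"
    by (metis (no_types, lifting) SUP_cong)
  also have "\<dots> = I +> x \<otimes> y"
    using coset_self [OF assms(1)] coset_self [OF assms(2)] by blast
  finally show ?thesis
    by (simp add: FactRing_def rcoset_mult_def)
qed

lemma quot_skew_brace: "skew_brace (A Quot I)"
proof -
  have grp: "group (add_monoid (A Quot I))"
  proof (rule groupI)
    fix X assume "X \<in> carrier (add_monoid (A Quot I))"
    then obtain x where x: "x \<in> carrier A" "X = I +> x" by (auto simp: quot_carrier)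
    then show "\<exists>Y\<in>carrier (add_monoid (A Quot I)).
        Y \<otimes>\<^bsub>add_monoid (A Quot I)\<^esub> X = \<one>\<^bsub>add_monoid (A Quot I)\<^esub>"
      by (intro bexI [of _ "I +> \<ominus> x"]) (simp_all add: quot_add quot_zero)
  qed (auto simp: quot_carrier quot_zero quot_add add.m_assoc)
  have neg: "\<ominus>\<^bsub>A Quot I\<^esub> (I +> x) = I +> \<ominus> x" if "x \<in> carrier A" for x
    unfolding a_inv_def [of "A Quot I"] using that
    by (intro group.inv_equality [OF grp]) (simp_all add: quot_zero quot_add)
  show ?thesis
  proof (rule skew_brace.intro)
    show "group (add_monoid (A Quot I))" by (rule grp)
    show "group (A Quot I)"
    proof (rule groupI)
      fix X assume "X \<in> carrier (A Quot I)"
      then obtain x where x: "x \<in> carrier A" "X = I +> x" by (auto simp: quot_carrier)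
      then show "\<exists>Y\<in>carrier (A Quot I). Y \<otimes>\<^bsub>A Quot I\<^esub> X = \<one>\<^bsub>A Quot I\<^esub>"
        by (intro bexI [of _ "I +> inv x"]) (simp_all add: quot_circ quot_one)
    qed (auto simp: quot_carrier quot_one quot_circ circ.m_assoc)
  qed (auto simp: quot_carrier quot_add quot_circ brace_distrib a_minus_def neg)
qed

lemma coset_hom: "(\<lambda>x. I +> x) \<in> skb_hom A (A Quot I)"
  by (auto simp: skb_hom_def hom_def quot_add quot_circ)

end

section \<open>Homomorphisms\<close>

locale skb_morphism = A: skew_brace A + B: skew_brace B
  for A :: "'a ring" and B :: "'b ring" +
  fixes h :: "'a \<Rightarrow> 'b"
  assumes hom: "h \<in> skb_hom A B"
begin

sublocale add: group_hom "add_monoid A" "add_monoid B" h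
  rewrites "carrier (add_monoid A) = carrier A"
    and "mult (add_monoid A) = add A"
    and "one (add_monoid A) = zero A"
    and "m_inv (add_monoid A) = a_inv A"
    and "carrier (add_monoid B) = carrier B"
    and "mult (add_monoid B) = add B"
    and "one (add_monoid B) = zero B"
    and "m_inv (add_monoid B) = a_inv B"
proof -
  show "group_hom (add_monoid A) (add_monoid B) h"
    using hom A.add_is_group B.add_is_group
    unfolding group_hom_def group_hom_axioms_def skb_hom_def by blast
qed (simp_all add: a_inv_def)

sublocale circ: group_hom A B h
  using hom A.circ_is_group B.circ_is_group
  unfolding group_hom_def group_hom_axioms_def skb_hom_def by blast

lemma hom_minus:
  "\<lbrakk>x \<in> carrier A; y \<in> carrier A\<rbrakk> \<Longrightarrow> h (x \<ominus>\<^bsub>A\<^esub> y) = h x \<ominus>\<^bsub>B\<^esub> h y"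
  by (simp add: a_minus_def)

lemma hom_star: "\<lbrakk>x \<in> carrier A; y \<in> carrier A\<rbrakk> \<Longrightarrow> h (star A x y) = star B (h x) (h y)"
  by (simp add: star_def hom_minus)

lemma hom_add_commutator:
  "\<lbrakk>x \<in> carrier A; y \<in> carrier A\<rbrakk> \<Longrightarrow> h (add_commutator A x y) = add_commutator B (h x) (h y)"
  by (simp add: add_commutator_def hom_minus)

lemma hom_circ_commutator:
  "\<lbrakk>x \<in> carrier A; y \<in> carrier A\<rbrakk> \<Longrightarrow> h (circ_commutator A x y) = circ_commutator B (h x) (h y)"
  by (simp add: circ_commutator_def)

lemma commutator_image:
  assumes "I \<subseteq> carrier A" "J \<subseteq> carrier B" "h ` I \<subseteq> J"
  shows "h ` commutator_Ab I A \<subseteq> commutator_Ab J B"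
proof -
  let ?U = "\<Union>i\<in>I. \<Union>b\<in>carrier A. {add_commutator A i b, star A i b, circ_commutator A i b}"
  let ?V = "\<Union>i\<in>J. \<Union>b\<in>carrier B. {add_commutator B i b, star B i b, circ_commutator B i b}"
  have U: "?U \<subseteq> carrier A" using assms by auto
  have "h u \<in> ?V" if "u \<in> ?U" for u
  proof -
    from that obtain i b where ib: "i \<in> I" "b \<in> carrier A"
      and u: "u \<in> {add_commutator A i b, star A i b, circ_commutator A i b}" by blast
    have "h u \<in> {add_commutator B (h i) (h b), star B (h i) (h b), circ_commutator B (h i) (h b)}"
      using ib u assms(1) by (auto simp: hom_star hom_add_commutator hom_circ_commutator)
    moreover have "h i \<in> J" "h b \<in> carrier B" using ib assms by auto
    ultimately show ?thesis by blast
  qed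
  then have V: "h ` ?U \<subseteq> ?V" by (rule image_subsetI)
  show ?thesis
    unfolding commutator_Ab_def add.generate_img [OF U, symmetric]
    by (rule B.add.mono_generate [OF V])
qed

text \<open>Surjectivity makes every b that occurs in a generator over J an image, so the generators
  correspond. This serves to lift elements of commutator ideals along the counit.\<close>

lemma commutator_image_eq:
  assumes "I \<subseteq> carrier A" "h ` carrier A = carrier B" "h ` I = J"
  shows "h ` commutator_Ab I A = commutator_Ab J B"
proof -
  let ?U = "\<Union>i\<in>I. \<Union>b\<in>carrier A. {add_commutator A i b, star A i b, circ_commutator A i b}"
  let ?V = "\<Union>i\<in>J. \<Union>b\<in>carrier B. {add_commutator B i b, star B i b, circ_commutator B i b}"
  have U: "?U \<subseteq> carrier A" using assms by auto
  have "h ` {add_commutator A i b, star A i b, circ_commutator A i b} =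
      {add_commutator B (h i) (h b), star B (h i) (h b), circ_commutator B (h i) (h b)}"
    if "i \<in> I" "b \<in> carrier A" for i b
    using that assms(1) by (auto simp: hom_star hom_add_commutator hom_circ_commutator)
  then have "h ` ?U = (\<Union>i\<in>I. \<Union>b\<in>carrier A.
      {add_commutator B (h i) (h b), star B (h i) (h b), circ_commutator B (h i) (h b)})"
    by (simp add: image_UN)
  also have "\<dots> = ?V"
    by (simp flip: assms(2,3))
  finally have V: "h ` ?U = ?V" .
  show ?thesis
    unfolding commutator_Ab_def add.generate_img [OF U, symmetric] V by simp
qed

text \<open>Supplies the kernel of a homomorphism, for J = {0}, and the preimages of the lower
  central terms under the counit.\<close>

lemma vimage_ideal:
  assumes "skb_ideal J B" shows "skb_ideal {x \<in> carrier A. h x \<in> J} A"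
proof -
  interpret J: skew_brace_ideal J B
    using assms by unfold_locales
  have "subgroup {x \<in> carrier A. h x \<in> J} (add_monoid A)"
    by (rule A.add.subgroupI) (auto intro!: exI [of _ "\<zero>\<^bsub>A\<^esub>"])
  then have "{x \<in> carrier A. h x \<in> J} \<lhd> add_monoid A"
    unfolding A.add.normal_inv_iff using J.I.inv_op_closed2 by auto
  then show ?thesis
    by (auto simp: skb_ideal_def hom_star J.star_mem)
qed

end

lemma skb_hom_compose:
  "\<lbrakk>g \<in> skb_hom B C; f \<in> skb_hom A B\<rbrakk> \<Longrightarrow> (\<lambda>x. g (f x)) \<in> skb_hom A C"
  by (auto simp: skb_hom_def hom_def Pi_iff)

lemma skb_morphism_compose:
  "\<lbrakk>skb_morphism B C g; skb_morphism A B f\<rbrakk> \<Longrightarrow> skb_morphism A C (\<lambda>x. g (f x))"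
  by (auto simp: skb_morphism_def skb_morphism_axioms_def skb_hom_compose)

lemma (in skew_brace_ideal) coset_morphism: "skb_morphism A (A Quot I) (\<lambda>x. I +> x)"
  using coset_hom quot_skew_brace skew_brace_axioms
  by (auto simp: skb_morphism_def skb_morphism_axioms_def)

lemma (in skew_brace) carrier_ideal: "skb_ideal (carrier A) A"
  unfolding skb_ideal_def add.normal_inv_iff using add.subgroup_self by auto

lemma (in skew_brace) zero_ideal: "skb_ideal {\<zero>} A"
proof -
  have "subgroup {\<zero>} (add_monoid A)"
    using add.triv_subgroup by simp
  then show ?thesis
    unfolding skb_ideal_def add.normal_inv_iff by (auto simp: star_def a_minus_def)
qed

section \<open>The annihilator\<close>

text \<open>Known as Ann(A): the intersection of the kernel of the lambda map with the centres of
  (A, +) and (A, \<circ>).\<close>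

definition skb_annihilator :: "'a ring \<Rightarrow> 'a set"
  where "skb_annihilator A = {s \<in> carrier A. \<forall>b\<in>carrier A.
    b \<oplus>\<^bsub>A\<^esub> s = s \<oplus>\<^bsub>A\<^esub> b \<and> s \<otimes>\<^bsub>A\<^esub> b = s \<oplus>\<^bsub>A\<^esub> b \<and> b \<otimes>\<^bsub>A\<^esub> s = s \<oplus>\<^bsub>A\<^esub> b}"

context skew_brace
begin

lemma annihilatorD:
  assumes "s \<in> skb_annihilator A"
  shows "s \<in> carrier A" "b \<in> carrier A \<Longrightarrow> b \<oplus> s = s \<oplus> b"
    "b \<in> carrier A \<Longrightarrow> s \<otimes> b = s \<oplus> b" "b \<in> carrier A \<Longrightarrow> b \<otimes> s = s \<oplus> b"
  using assms by (auto simp: skb_annihilator_def)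

text \<open>As s is central in both groups and s + w = s \<circ> w, it can be moved until it meets
  its inverse.\<close>

lemma annihilator_shift_left:
  assumes s: "s \<in> skb_annihilator A" and "x \<in> carrier A" "y \<in> carrier A"
  shows "add_commutator A (s \<oplus> x) y = add_commutator A x y"
    "star A (s \<oplus> x) y = star A x y"
    "circ_commutator A (s \<oplus> x) y = circ_commutator A x y"
proof -
  note [simp] = annihilatorD(1) [OF s]
  have "add_commutator A (s \<oplus> x) y = s \<oplus> (x \<oplus> y \<oplus> \<ominus> x) \<oplus> \<ominus> s \<oplus> \<ominus> y"
    using assms by (simp add: add_commutator_def a_minus_def add.inv_mult_group add.m_assoc)
  also have "s \<oplus> (x \<oplus> y \<oplus> \<ominus> x) = (x \<oplus> y \<oplus> \<ominus> x) \<oplus> s"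
    using assms annihilatorD(2) [OF s] by simp
  finally show "add_commutator A (s \<oplus> x) y = add_commutator A x y"
    using assms by (simp add: add_commutator_def a_minus_def add.m_assoc)
  have sx: "s \<oplus> x = s \<otimes> x" using assms annihilatorD(3) [OF s] by simp
  have "(s \<oplus> x) \<otimes> y = s \<oplus> (x \<otimes> y)"
    using assms annihilatorD(3) [OF s, of x] annihilatorD(3) [OF s, of "x \<otimes> y"]
      circ.m_assoc [of s x y] by simp
  then show "star A (s \<oplus> x) y = star A x y"
    using assms by (simp add: star_def a_minus_def add.inv_mult_group add.m_assoc)
  have "circ_commutator A (s \<oplus> x) y = s \<otimes> (x \<otimes> y \<otimes> inv x) \<otimes> inv s \<otimes> inv y"
    using assms by (simp add: sx circ_commutator_def circ.inv_mult_group circ.m_assoc)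
  also have "s \<otimes> (x \<otimes> y \<otimes> inv x) = (x \<otimes> y \<otimes> inv x) \<otimes> s"
    using assms annihilatorD(3,4) [OF s] by simp
  finally show "circ_commutator A (s \<oplus> x) y = circ_commutator A x y"
    using assms by (simp add: circ_commutator_def circ.m_assoc)
qed

lemma annihilator_shift_right:
  assumes s: "s \<in> skb_annihilator A" and "x \<in> carrier A" "y \<in> carrier A"
  shows "add_commutator A x (s \<oplus> y) = add_commutator A x y"
    "star A x (s \<oplus> y) = star A x y"
    "circ_commutator A x (s \<oplus> y) = circ_commutator A x y"
proof -
  note [simp] = annihilatorD(1) [OF s]
  \<comment> \<open>In each of the three expressions s reaches the left end and its inverse stands
    at the right end. What remains is a conjugation by s, which is trivial in both groups.\<close>
  have *: "s \<oplus> w \<oplus> \<ominus> s = w" if "w \<in> carrier A" for w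
    using that annihilatorD(2) [OF s, of w, symmetric] by simp
  have **: "s \<otimes> w \<otimes> inv s = w" if "w \<in> carrier A" for w
    using that annihilatorD(3,4) [OF s, of w]
    by (metis annihilatorD(1) circ_cancel(3) s)
  have "add_commutator A x (s \<oplus> y) = (x \<oplus> s) \<oplus> y \<oplus> \<ominus> x \<oplus> \<ominus> y \<oplus> \<ominus> s"
    using assms by (simp add: add_commutator_def a_minus_def add.inv_mult_group add.m_assoc)
  also have "x \<oplus> s = s \<oplus> x"
    using assms annihilatorD(2) [OF s] by simp
  finally show "add_commutator A x (s \<oplus> y) = add_commutator A x y"
    using assms * [of "x \<oplus> y \<oplus> \<ominus> x \<oplus> \<ominus> y"]
    by (simp add: add_commutator_def a_minus_def add.m_assoc)
  have sy: "s \<oplus> y = s \<otimes> y" using assms annihilatorD(3) [OF s] by simp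
  have xs: "x \<otimes> s = s \<otimes> x" using assms annihilatorD(3,4) [OF s] by simp
  have "x \<otimes> (s \<oplus> y) = s \<oplus> (x \<otimes> y)"
    using assms annihilatorD(3) [OF s, of "x \<otimes> y"]
    by (metis sy xs annihilatorD(1) circ.m_assoc circ.m_closed)
  then have "star A x (s \<oplus> y) = (\<ominus> x \<oplus> s) \<oplus> x \<otimes> y \<oplus> \<ominus> y \<oplus> \<ominus> s"
    using assms by (simp add: star_def a_minus_def add.inv_mult_group add.m_assoc)
  also have "\<ominus> x \<oplus> s = s \<oplus> \<ominus> x"
    using assms annihilatorD(2) [OF s] by simp
  finally show "star A x (s \<oplus> y) = star A x y"
    using assms * [of "\<ominus> x \<oplus> x \<otimes> y \<oplus> \<ominus> y"]
    by (simp add: star_def a_minus_def add.m_assoc)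
  have "circ_commutator A x (s \<oplus> y) = (x \<otimes> s) \<otimes> y \<otimes> inv x \<otimes> inv y \<otimes> inv s"
    using assms by (simp add: sy circ_commutator_def circ.inv_mult_group circ.m_assoc)
  also have "x \<otimes> s = s \<otimes> x" by (rule xs)
  finally show "circ_commutator A x (s \<oplus> y) = circ_commutator A x y"
    using assms ** [of "x \<otimes> y \<otimes> inv x \<otimes> inv y"]
    by (simp add: circ_commutator_def circ.m_assoc)
qed

lemma add_commutator_eq_zero:
  assumes "a \<in> carrier A" "b \<in> carrier A" "add_commutator A a b = \<zero>"
  shows "b \<oplus> a = a \<oplus> b"
proof -
  have "a \<oplus> b = add_commutator A a b \<oplus> (b \<oplus> a)"
    using assms(1,2) by (simp add: add_commutator_def a_minus_def add.m_assoc)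
  then show ?thesis using assms by simp
qed

lemma star_eq_zero:
  assumes "a \<in> carrier A" "b \<in> carrier A" "star A a b = \<zero>"
  shows "a \<otimes> b = a \<oplus> b"
  using assms by (simp add: circ_eq_star)

lemma circ_commutator_eq_zero:
  assumes "a \<in> carrier A" "b \<in> carrier A" "circ_commutator A a b = \<zero>"
  shows "b \<otimes> a = a \<otimes> b"
proof -
  have "a \<otimes> b = circ_commutator A a b \<otimes> (b \<otimes> a)"
    using assms(1,2) by (simp add: circ_commutator_def circ.m_assoc)
  then show ?thesis using assms by simp
qed

end

text \<open>The two commutators and the star product of x with any b are generators of [I, A], hence
  vanish in the quotient; their vanishing yields the three equations of the annihilator.\<close>

lemma (in skew_brace_ideal) coset_annihilator:
  assumes "x \<in> I"
  shows "commutator_Ab I A +> x \<in> skb_annihilator (A Quot commutator_Ab I A)"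
proof -
  let ?K = "commutator_Ab I A"
  interpret K: skew_brace_ideal ?K A
    using commutator_ideal by unfold_locales
  interpret p: skb_morphism A "A Quot ?K" "\<lambda>x. ?K +> x"
    by (rule K.coset_morphism)
  have zero: "?K +> y = \<zero>\<^bsub>A Quot ?K\<^esub>" if "y \<in> ?K" for y
    unfolding K.quot_zero using that K.coset_eq_zero_iff K.sub_carrier by blast
  have "(?K +> b) \<oplus>\<^bsub>A Quot ?K\<^esub> (?K +> x) = (?K +> x) \<oplus>\<^bsub>A Quot ?K\<^esub> (?K +> b) \<and>
      (?K +> x) \<otimes>\<^bsub>A Quot ?K\<^esub> (?K +> b) = (?K +> x) \<oplus>\<^bsub>A Quot ?K\<^esub> (?K +> b) \<and>
      (?K +> b) \<otimes>\<^bsub>A Quot ?K\<^esub> (?K +> x) = (?K +> x) \<oplus>\<^bsub>A Quot ?K\<^esub> (?K +> b)"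
    if "b \<in> carrier A" for b
  proof -
    let ?s = "?K +> x" and ?b = "?K +> b"
    have "?s \<in> carrier (A Quot ?K)" "?b \<in> carrier (A Quot ?K)"
      using that assms by (simp_all add: sub_carrier)
    moreover have "add_commutator (A Quot ?K) ?s ?b = \<zero>\<^bsub>A Quot ?K\<^esub>"
        "star (A Quot ?K) ?s ?b = \<zero>\<^bsub>A Quot ?K\<^esub>"
        "circ_commutator (A Quot ?K) ?s ?b = \<zero>\<^bsub>A Quot ?K\<^esub>"
      using that assms commutator_gen [of x b, THEN zero]
      by (simp_all add: sub_carrier p.hom_star p.hom_add_commutator p.hom_circ_commutator)
    ultimately show ?thesis
      using p.B.add_commutator_eq_zero p.B.star_eq_zero p.B.circ_commutator_eq_zero by metis
  qed
  then show ?thesis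
    using assms by (auto simp: skb_annihilator_def K.quot_carrier sub_carrier)
qed

text \<open>The shift lemmas give agreement on the generators of [C, C], and the elements on which u
  and v agree form a subgroup.\<close>

lemma homs_agree_on_commutator:
  assumes u: "skb_morphism C Q u" and v: "skb_morphism C Q v"
    and diff: "\<And>y. y \<in> carrier C \<Longrightarrow> \<exists>s\<in>skb_annihilator Q. u y = s \<oplus>\<^bsub>Q\<^esub> v y"
    and z: "z \<in> commutator_Ab (carrier C) C"
  shows "u z = v z"
proof -
  interpret u: skb_morphism C Q u by (rule u)
  interpret v: skb_morphism C Q v by (rule v)
  have gen: "add_commutator Q (u a) (u b) = add_commutator Q (v a) (v b)"
      "star Q (u a) (u b) = star Q (v a) (v b)"
      "circ_commutator Q (u a) (u b) = circ_commutator Q (v a) (v b)"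
    if ab: "a \<in> carrier C" "b \<in> carrier C" for a b
  proof -
    obtain s t where s: "s \<in> skb_annihilator Q" "u a = s \<oplus>\<^bsub>Q\<^esub> v a"
      and t: "t \<in> skb_annihilator Q" "u b = t \<oplus>\<^bsub>Q\<^esub> v b"
      using diff ab by blast
    then show "add_commutator Q (u a) (u b) = add_commutator Q (v a) (v b)"
      "star Q (u a) (u b) = star Q (v a) (v b)"
      "circ_commutator Q (u a) (u b) = circ_commutator Q (v a) (v b)"
      using ab u.B.annihilatorD(1)
      by (simp_all add: u.B.annihilator_shift_left u.B.annihilator_shift_right)
  qed
  have "subgroup {x \<in> carrier C. u x = v x} (add_monoid C)"
    by (rule u.A.add.subgroupI) (auto intro!: exI [of _ "\<zero>\<^bsub>C\<^esub>"])
  moreover have "(\<Union>i\<in>carrier C. \<Union>b\<in>carrier C.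
      {add_commutator C i b, star C i b, circ_commutator C i b}) \<subseteq> {x \<in> carrier C. u x = v x}"
    by (auto simp: gen u.hom_star v.hom_star u.hom_add_commutator v.hom_add_commutator
        u.hom_circ_commutator v.hom_circ_commutator)
  ultimately have "commutator_Ab (carrier C) C \<subseteq> {x \<in> carrier C. u x = v x}"
    unfolding commutator_Ab_def by (intro u.A.add.generate_subgroup_incl)
  then show ?thesis using z by blast
qed

section \<open>Free skew braces\<close>

lemma skb_terms_simps [simp]:
  "Gen x \<in> skb_terms X \<longleftrightarrow> x \<in> X" "Zero \<in> skb_terms X" "One \<in> skb_terms X"
  "skb_term.Add s t \<in> skb_terms X \<longleftrightarrow> s \<in> skb_terms X \<and> t \<in> skb_terms X"
  "skb_term.Circ s t \<in> skb_terms X \<longleftrightarrow> s \<in> skb_terms X \<and> t \<in> skb_terms X"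
  "skb_term.Neg s \<in> skb_terms X \<longleftrightarrow> s \<in> skb_terms X"
  "skb_term.Inv s \<in> skb_terms X \<longleftrightarrow> s \<in> skb_terms X"
  by (auto simp: skb_terms_def)

lemma skb_class_eqI: "skb_cong X s t \<Longrightarrow> skb_class X s = skb_class X t"
  by (auto simp: skb_class_def intro: skb_cong.sym skb_cong.trans)

lemmas skb_class_axioms =
  skb_cong.add_assoc [THEN skb_class_eqI] skb_cong.add_zero [THEN skb_class_eqI]
  skb_cong.add_neg [THEN skb_class_eqI] skb_cong.circ_assoc [THEN skb_class_eqI]
  skb_cong.circ_one [THEN skb_class_eqI] skb_cong.circ_inv [THEN skb_class_eqI]
  skb_cong.distrib [THEN skb_class_eqI]

lemma skb_class_self: "t \<in> skb_terms X \<Longrightarrow> t \<in> skb_class X t"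
  by (simp add: skb_class_def skb_cong.refl)

text \<open>Maps on classes are defined as unions over representatives; invariance under the
  congruence collapses such a union to a single value.\<close>

lemma skb_class_UN:
  assumes "t \<in> skb_terms X" and "\<And>t'. skb_cong X t t' \<Longrightarrow> F t' = F t"
  shows "(\<Union>t'\<in>skb_class X t. F t') = F t"
proof -
  have "(\<Union>t'\<in>skb_class X t. F t') = (\<Union>t'\<in>skb_class X t. F t)"
    by (intro SUP_cong) (simp_all add: skb_class_def assms(2))
  also have "\<dots> = F t" using skb_class_self [OF assms(1)] by blast
  finally show ?thesis .
qed

lemma skb_class_UN2:
  assumes "s \<in> skb_terms X" "t \<in> skb_terms X"
    and "\<And>s' t'. \<lbrakk>skb_cong X s s'; skb_cong X t t'\<rbrakk> \<Longrightarrow> F s' t' = F s t"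
  shows "(\<Union>s'\<in>skb_class X s. \<Union>t'\<in>skb_class X t. F s' t') = F s t"
proof -
  have "(\<Union>s'\<in>skb_class X s. \<Union>t'\<in>skb_class X t. F s' t') =
      (\<Union>s'\<in>skb_class X s. \<Union>t'\<in>skb_class X t. F s t)"
    by (intro SUP_cong) (simp_all add: skb_class_def assms(3))
  also have "\<dots> = F s t"
    using skb_class_self [OF assms(1)] skb_class_self [OF assms(2)] by blast
  finally show ?thesis .
qed

lemma free_carrier: "carrier (free_skb X) = skb_class X ` skb_terms X"
  by (simp add: free_skb_def)

lemma free_zero: "\<zero>\<^bsub>free_skb X\<^esub> = skb_class X Zero"
  by (simp add: free_skb_def)

lemma free_one: "\<one>\<^bsub>free_skb X\<^esub> = skb_class X One"
  by (simp add: free_skb_def)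

lemma free_add:
  assumes "s \<in> skb_terms X" "t \<in> skb_terms X"
  shows "skb_class X s \<oplus>\<^bsub>free_skb X\<^esub> skb_class X t = skb_class X (skb_term.Add s t)"
proof -
  have "(\<Union>s'\<in>skb_class X s. \<Union>t'\<in>skb_class X t. skb_class X (skb_term.Add s' t')) =
      skb_class X (skb_term.Add s t)"
    using assms
    by (rule skb_class_UN2) (rule skb_class_eqI, rule skb_cong.Add; rule skb_cong.sym)
  then show ?thesis by (simp add: free_skb_def)
qed

lemma free_circ:
  assumes "s \<in> skb_terms X" "t \<in> skb_terms X"
  shows "skb_class X s \<otimes>\<^bsub>free_skb X\<^esub> skb_class X t = skb_class X (skb_term.Circ s t)"
proof -
  have "(\<Union>s'\<in>skb_class X s. \<Union>t'\<in>skb_class X t. skb_class X (skb_term.Circ s' t')) =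
      skb_class X (skb_term.Circ s t)"
    using assms
    by (rule skb_class_UN2) (rule skb_class_eqI, rule skb_cong.Circ; rule skb_cong.sym)
  then show ?thesis by (simp add: free_skb_def)
qed

lemma free_add_group: "group (add_monoid (free_skb X))"
proof (rule groupI)
  fix P assume "P \<in> carrier (add_monoid (free_skb X))"
  then obtain t where "t \<in> skb_terms X" "P = skb_class X t" by (auto simp: free_carrier)
  then show "\<exists>Q\<in>carrier (add_monoid (free_skb X)).
      Q \<otimes>\<^bsub>add_monoid (free_skb X)\<^esub> P = \<one>\<^bsub>add_monoid (free_skb X)\<^esub>"
    by (intro bexI [of _ "skb_class X (skb_term.Neg t)"])
      (simp_all add: free_carrier free_add free_zero skb_class_axioms)
qed (auto simp: free_carrier free_add free_zero skb_class_axioms)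

lemma free_circ_group: "group (free_skb X)"
proof (rule groupI)
  fix P assume "P \<in> carrier (free_skb X)"
  then obtain t where "t \<in> skb_terms X" "P = skb_class X t" by (auto simp: free_carrier)
  then show "\<exists>Q\<in>carrier (free_skb X). Q \<otimes>\<^bsub>free_skb X\<^esub> P = \<one>\<^bsub>free_skb X\<^esub>"
    by (intro bexI [of _ "skb_class X (skb_term.Inv t)"])
      (simp_all add: free_carrier free_circ free_one skb_class_axioms)
qed (auto simp: free_carrier free_circ free_one skb_class_axioms)

lemma free_neg:
  assumes "t \<in> skb_terms X"
  shows "\<ominus>\<^bsub>free_skb X\<^esub> skb_class X t = skb_class X (skb_term.Neg t)"
  unfolding a_inv_def [of "free_skb X"] using assms
  by (intro group.inv_equality [OF free_add_group])
    (simp_all add: free_carrier free_add free_zero skb_class_axioms)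

lemma free_inv:
  assumes "t \<in> skb_terms X"
  shows "inv\<^bsub>free_skb X\<^esub> skb_class X t = skb_class X (skb_term.Inv t)"
  using assms
  by (intro group.inv_equality [OF free_circ_group])
    (simp_all add: free_carrier free_circ free_one skb_class_axioms)

lemma free_skew_brace: "skew_brace (free_skb X)"
proof (rule skew_brace.intro [OF free_add_group free_circ_group])
qed (auto simp: free_carrier free_add free_circ free_neg a_minus_def skb_class_axioms)

section \<open>The objects G(A) and the counit\<close>

lemma skew_brace_free_G [simp]: "skew_brace (free_G A)"
  by (simp add: free_G_def free_skew_brace)

abbreviation free_gen :: "'a ring \<Rightarrow> 'a \<Rightarrow> 'a skb_term set"
  where "free_gen A a \<equiv> skb_class (carrier A) (Gen a)"

lemma free_gen_closed [simp]: "a \<in> carrier A \<Longrightarrow> free_gen A a \<in> carrier (free_G A)"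
  by (simp add: free_G_def free_carrier)

lemma free_G_cases:
  assumes "P \<in> carrier (free_G A)"
  obtains t where "t \<in> skb_terms (carrier A)" "P = skb_class (carrier A) t"
  using assms by (auto simp: free_G_def free_carrier)

context skew_brace
begin

lemma skb_eval_closed: "t \<in> skb_terms (carrier A) \<Longrightarrow> skb_eval A t \<in> carrier A"
  by (induction t) auto

text \<open>A satisfies every axiom that generates the congruence. Hence \<open>skb_eval\<close>
  maps a class to a singleton, as the \<open>the_elem\<close> in \<open>counit\<close>
  presupposes.\<close>

lemma skb_eval_cong: "skb_cong (carrier A) s t \<Longrightarrow> skb_eval A s = skb_eval A t"
proof (induction rule: skb_cong.induct)
  case (distrib s t u)
  then show ?case by (simp add: skb_eval_closed brace_distrib a_minus_def)
qed (simp_all add: skb_eval_closed add.m_assoc circ.m_assoc)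

lemma counit_class:
  assumes "t \<in> skb_terms (carrier A)"
  shows "counit A (skb_class (carrier A) t) = skb_eval A t"
proof -
  have "skb_eval A s = skb_eval A t" if "s \<in> skb_class (carrier A) t" for s
    using that skb_eval_cong [of t s] by (simp add: skb_class_def)
  then have "skb_eval A ` skb_class (carrier A) t = {skb_eval A t}"
    using skb_class_self [OF assms] by blast
  then show ?thesis by (simp add: counit_def)
qed

lemma counit_gen: "a \<in> carrier A \<Longrightarrow> counit A (free_gen A a) = a"
  by (simp add: counit_class)

lemma counit_morphism: "skb_morphism (free_G A) A (counit A)"
proof -
  have "counit A \<in> skb_hom (free_G A) A"
    by (auto simp: skb_hom_def hom_def free_G_def free_carrier free_add free_circ counit_class
        skb_eval_closed)
  then show ?thesis
    using skew_brace_axioms by (simp add: skb_morphism_def skb_morphism_axioms_def)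
qed

end

section \<open>Functoriality of G and naturality of the counit\<close>

lemma map_skb_terms:
  "\<lbrakk>t \<in> skb_terms X; f \<in> X \<rightarrow> Y\<rbrakk> \<Longrightarrow> map_skb_term f t \<in> skb_terms Y"
  by (auto simp: skb_terms_def skb_term.set_map)

lemma map_skb_cong:
  "\<lbrakk>skb_cong X s t; f \<in> X \<rightarrow> Y\<rbrakk> \<Longrightarrow> skb_cong Y (map_skb_term f s) (map_skb_term f t)"
proof (induction rule: skb_cong.induct)
  case (trans s t u)
  then show ?case using skb_cong.trans by blast
qed (auto intro: skb_cong.intros map_skb_terms)

lemma free_G_map_class:
  assumes "f \<in> carrier A \<rightarrow> carrier B" "t \<in> skb_terms (carrier A)"
  shows "free_G_map B f (skb_class (carrier A) t) = skb_class (carrier B) (map_skb_term f t)"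
  unfolding free_G_map_def using assms
  by (intro skb_class_UN) (metis map_skb_cong skb_class_eqI)+

lemma free_G_map_gen:
  "\<lbrakk>f \<in> carrier A \<rightarrow> carrier B; a \<in> carrier A\<rbrakk>
    \<Longrightarrow> free_G_map B f (free_gen A a) = free_gen B (f a)"
  by (simp add: free_G_map_class)

lemma free_G_map_morphism:
  assumes "f \<in> carrier A \<rightarrow> carrier B"
  shows "skb_morphism (free_G A) (free_G B) (free_G_map B f)"
proof -
  have "free_G_map B f \<in> skb_hom (free_G A) (free_G B)"
    using assms
    by (auto simp: skb_hom_def hom_def free_G_def free_carrier free_add free_circ free_G_map_class
        map_skb_terms)
  then show ?thesis
    by (simp add: skb_morphism_def skb_morphism_axioms_def)
qed

lemma free_G_map_compose:
  assumes "f \<in> carrier A \<rightarrow> carrier B" "g \<in> carrier B \<rightarrow> carrier C" "P \<in> carrier (free_G A)"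
  shows "free_G_map C g (free_G_map B f P) = free_G_map C (\<lambda>x. g (f x)) P"
proof -
  have "(\<lambda>x. g (f x)) \<in> carrier A \<rightarrow> carrier C" using assms by auto
  then show ?thesis
    using assms
    by (auto elim!: free_G_cases
        simp: free_G_map_class map_skb_terms skb_term.map_comp o_def)
qed

text \<open>The values of f and g off \<open>carrier A\<close> are arbitrary; the terms involved
  contain only generators from the carrier.\<close>

lemma free_G_map_cong:
  assumes "f \<in> carrier A \<rightarrow> carrier B" "P \<in> carrier (free_G A)"
    and eq: "\<And>x. x \<in> carrier A \<Longrightarrow> f x = g x"
  shows "free_G_map B f P = free_G_map B g P"
proof -
  have g: "g \<in> carrier A \<rightarrow> carrier B" using assms(1) eq by (metis Pi_cong)
  obtain t where t: "t \<in> skb_terms (carrier A)" "P = skb_class (carrier A) t"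
    using assms(2) by (rule free_G_cases)
  have "map_skb_term f t = map_skb_term g t"
    using t eq by (intro skb_term.map_cong0) (auto simp: skb_terms_def)
  then show ?thesis using t g assms(1) by (simp add: free_G_map_class)
qed

context skb_morphism
begin

lemma Pi: "h \<in> carrier A \<rightarrow> carrier B"
  by auto

lemma eval_natural:
  "t \<in> skb_terms (carrier A) \<Longrightarrow> skb_eval B (map_skb_term h t) = h (skb_eval A t)"
  by (induction t) (auto simp: A.skb_eval_closed)

text \<open>Evaluation commutes with a homomorphism term by term. Taking counits and faces for h
  turns this naturality into simplicial identities.\<close>

lemma counit_natural:
  assumes "P \<in> carrier (free_G A)"
  shows "counit B (free_G_map B h P) = h (counit A P)"
  using assms
  by (auto elim!: free_G_cases simp: free_G_map_class [OF Pi] map_skb_terms [OF _ Pi]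
      B.counit_class A.counit_class eval_natural)

end

section \<open>Induced maps on quotients\<close>

text \<open>
  \<^term>\<open>add_monoid A\<close> abbreviates a record whose extension field is \<open>undefined :: unit\<close>. The simproc
  would rewrite that field to \<open>()\<close>, after which no rewrite rule on \<^term>\<open>add_monoid A\<close> applies.
\<close>

declare [[simproc del: unit_eq]]

abbreviation derived_ideal :: "'a ring \<Rightarrow> 'a set"
  where "derived_ideal A \<equiv> commutator_Ab (carrier A) A"

abbreviation ab_class :: "'a ring \<Rightarrow> 'a \<Rightarrow> 'a set"
  where "ab_class A x \<equiv> derived_ideal A +>\<^bsub>A\<^esub> x"

lemma skb_morphism_group_hom:
  "skb_morphism A B h \<Longrightarrow> group_hom (add_monoid A) (add_monoid B) h"
  unfolding skb_morphism_def skb_morphism_axioms_def group_hom_def group_hom_axioms_def skb_hom_def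
  by (blast intro: skew_brace.add_is_group)

text \<open>A member i c of the coset goes to (k i)(k c) with k i in K, so all sets in the union
  coincide. The formulation for groups covers skew brace quotients and homology groups
  alike.\<close>

lemma coset_map_r_coset:
  assumes "group_hom G H k" "subgroup N G" "subgroup K H" "k ` N \<subseteq> K" "c \<in> carrier G"
  shows "coset_map H K k (N #>\<^bsub>G\<^esub> c) = K #>\<^bsub>H\<^esub> k c"
proof -
  interpret k: group_hom G H k by fact
  interpret N: subgroup N G by fact
  interpret K: subgroup K H by fact
  have "K #>\<^bsub>H\<^esub> k x = K #>\<^bsub>H\<^esub> k c" if x: "x \<in> N #>\<^bsub>G\<^esub> c" for x
  proof -
    obtain i where i: "i \<in> N" "x = i \<otimes>\<^bsub>G\<^esub> c" using x by (auto simp: r_coset_def)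
    then have "k x = k i \<otimes>\<^bsub>H\<^esub> k c" using assms(5) by simp
    moreover have "k i \<in> K" using i assms(4) by auto
    ultimately have "k x \<in> K #>\<^bsub>H\<^esub> k c" by (auto simp: r_coset_def)
    then show ?thesis
      using k.H.repr_independence [of "k x" K "k c"] assms K.subgroup_axioms by simp
  qed
  then have "coset_map H K k (N #>\<^bsub>G\<^esub> c) = (\<Union>x\<in>N #>\<^bsub>G\<^esub> c. K #>\<^bsub>H\<^esub> k c)"
    unfolding coset_map_def by (rule SUP_cong [OF HOL.refl])
  also have "\<dots> = K #>\<^bsub>H\<^esub> k c"
    using k.G.rcos_self [OF assms(5,2)] by blast
  finally show ?thesis .
qed

lemma (in skew_brace) skew_brace_idealI: "skb_ideal I A \<Longrightarrow> skew_brace_ideal I A"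
  by (simp add: skew_brace_ideal_def skew_brace_ideal_axioms_def skew_brace_axioms)

section \<open>The reflector ab on representatives\<close>

lemma (in skew_brace) derived_ideal: "skb_ideal (derived_ideal A) A"
  by (rule skew_brace_ideal.commutator_ideal [OF skew_brace_idealI [OF carrier_ideal]])

lemma (in skew_brace) derived_skew_brace_ideal: "skew_brace_ideal (derived_ideal A) A"
  by (rule skew_brace_idealI [OF derived_ideal])

lemma (in skew_brace) ab_skew_brace: "skew_brace (ab A)"
  unfolding ab_def by (rule skew_brace_ideal.quot_skew_brace [OF derived_skew_brace_ideal])

lemma (in skew_brace) ab_carrier: "carrier (ab A) = ab_class A ` carrier A"
  unfolding ab_def by (rule skew_brace_ideal.quot_carrier [OF derived_skew_brace_ideal])

lemma (in skew_brace) ab_add: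
  "\<lbrakk>x \<in> carrier A; y \<in> carrier A\<rbrakk> \<Longrightarrow> ab_class A x \<oplus>\<^bsub>ab A\<^esub> ab_class A y = ab_class A (x \<oplus> y)"
  unfolding ab_def by (rule skew_brace_ideal.quot_add [OF derived_skew_brace_ideal])

lemma (in skew_brace) ab_zero: "\<zero>\<^bsub>ab A\<^esub> = ab_class A \<zero>"
  unfolding ab_def by (rule skew_brace_ideal.quot_zero [OF derived_skew_brace_ideal])

lemma (in skew_brace) ab_class_eq_zero:
  "x \<in> carrier A \<Longrightarrow> ab_class A x = ab_class A \<zero> \<longleftrightarrow> x \<in> derived_ideal A"
  by (rule skew_brace_ideal.coset_eq_zero_iff [OF derived_skew_brace_ideal])

context skb_morphism
begin

lemma coset_map_coset:
  assumes "skb_ideal I A" "skb_ideal J B" "h ` I \<subseteq> J" "x \<in> carrier A"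
  shows "coset_map (add_monoid B) J h (I +>\<^bsub>A\<^esub> x) = J +>\<^bsub>B\<^esub> h x"
  unfolding a_r_coset_def
  using assms skb_morphism_group_hom [OF skb_morphism_axioms]
  by (intro coset_map_r_coset) (auto simp: skb_ideal_def normal_def)

lemma quot_morphism:
  assumes "skb_ideal I A" "skb_ideal J B" "h ` I \<subseteq> J"
  shows "skb_morphism (A Quot I) (B Quot J) (coset_map (add_monoid B) J h)"
proof -
  interpret I: skew_brace_ideal I A using assms by (intro A.skew_brace_idealI)
  interpret J: skew_brace_ideal J B using assms by (intro B.skew_brace_idealI)
  have "coset_map (add_monoid B) J h \<in> skb_hom (A Quot I) (B Quot J)"
    by (auto simp: skb_hom_def hom_def I.quot_carrier I.quot_add I.quot_circ J.quot_add
        J.quot_circ coset_map_coset [OF assms])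
  then show ?thesis
    using I.quot_skew_brace J.quot_skew_brace
    by (simp add: skb_morphism_def skb_morphism_axioms_def)
qed

lemma derived_ideal_image: "h ` derived_ideal A \<subseteq> derived_ideal B"
  by (rule commutator_image) auto

lemma derived_ideal_hom: "x \<in> derived_ideal A \<Longrightarrow> h x \<in> derived_ideal B"
  using derived_ideal_image by auto

lemma ab_map_class:
  "x \<in> carrier A \<Longrightarrow> ab_map B h (ab_class A x) = ab_class B (h x)"
  unfolding ab_map_def
  by (rule coset_map_coset [OF A.derived_ideal B.derived_ideal derived_ideal_image])

lemma ab_class_hom:
  "\<lbrakk>x \<in> carrier A; y \<in> carrier A; ab_class A x = ab_class A y\<rbrakk> \<Longrightarrow> ab_class B (h x) = ab_class B (h y)"
  by (metis ab_map_class)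

lemma ab_map_morphism: "skb_morphism (ab A) (ab B) (ab_map B h)"
  unfolding ab_def ab_map_def
  by (rule quot_morphism [OF A.derived_ideal B.derived_ideal derived_ideal_image])

text \<open>For h a face map this expresses Moore cycles through elements of free skew braces, where
  the arguments about [C, C] take place.\<close>

lemma ab_kernel_iff:
  assumes "x \<in> carrier A"
  shows "ab_class A x \<in> kernel (add_monoid (ab A)) (add_monoid (ab B)) (ab_map B h) \<longleftrightarrow>
    h x \<in> derived_ideal B"
  using assms by (auto simp: kernel_def A.ab_carrier ab_map_class B.ab_zero B.ab_class_eq_zero)

lemma ab_kernel_sub:
  "kernel (add_monoid (ab A)) (add_monoid (ab B)) (ab_map B h) \<subseteq> ab_class A ` carrier A"
  by (auto simp: kernel_def A.ab_carrier)

end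

section \<open>The simplicial object in low degrees\<close>

context skew_brace
begin

lemma face10_morphism: "skb_morphism (free_G (free_G A)) (free_G A) (face10 A)"
  unfolding face10_def by (rule skew_brace.counit_morphism) simp

lemma face11_morphism: "skb_morphism (free_G (free_G A)) (free_G A) (face11 A)"
  unfolding face11_def by (intro free_G_map_morphism skb_morphism.Pi counit_morphism)

lemma face20_morphism:
  "skb_morphism (free_G (free_G (free_G A))) (free_G (free_G A)) (face20 A)"
  unfolding face20_def by (rule skew_brace.counit_morphism) simp

lemma face21_morphism:
  "skb_morphism (free_G (free_G (free_G A))) (free_G (free_G A)) (face21 A)"
  unfolding face21_def face10_def [symmetric]
  by (intro free_G_map_morphism skb_morphism.Pi face10_morphism)

lemma face22_morphism:
  "skb_morphism (free_G (free_G (free_G A))) (free_G (free_G A)) (face22 A)"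
  unfolding face22_def face11_def [symmetric]
  by (intro free_G_map_morphism skb_morphism.Pi face11_morphism)

text \<open>Naturality of \<epsilon> at the morphism \<epsilon> itself.\<close>

lemma counit_face:
  "y \<in> carrier (free_G (free_G A)) \<Longrightarrow> counit A (face11 A y) = counit A (face10 A y)"
  unfolding face11_def face10_def by (rule skb_morphism.counit_natural [OF counit_morphism])

text \<open>The simplicial identity d0 d1 = d0 d0 is naturality of the counit at d0; the next one,
  d0 d2 = d1 d0, is naturality at d1.\<close>

lemma face10_face21:
  assumes "w \<in> carrier (free_G (free_G (free_G A)))"
  shows "face10 A (face21 A w) = face10 A (face20 A w)"
  unfolding face21_def face20_def face10_def
  using skb_morphism.counit_natural [OF face10_morphism assms] by (simp add: face10_def)

lemma face10_face22:
  assumes "w \<in> carrier (free_G (free_G (free_G A)))"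
  shows "face10 A (face22 A w) = face11 A (face20 A w)"
  unfolding face22_def face20_def face10_def
  using skb_morphism.counit_natural [OF face11_morphism assms] by (simp add: face11_def)

text \<open>The functor G applied to \<open>counit_face\<close>, since all faces involved are values
  of G on morphisms.\<close>

lemma face11_face22:
  assumes "w \<in> carrier (free_G (free_G (free_G A)))"
  shows "face11 A (face22 A w) = face11 A (face21 A w)"
proof -
  note Pi = skb_morphism.Pi [OF counit_morphism]
    skb_morphism.Pi [OF face10_morphism] skb_morphism.Pi [OF face11_morphism]
  have "face11 A (face22 A w) = free_G_map A (\<lambda>x. counit A (face11 A x)) w"
    unfolding face22_def face11_def [symmetric]
    using free_G_map_compose [OF Pi(3) Pi(1) assms] by (simp add: face11_def)
  also have "\<dots> = free_G_map A (\<lambda>x. counit A (face10 A x)) w"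
    using Pi assms by (intro free_G_map_cong [where A = "free_G (free_G A)"]) (auto simp: counit_face)
  also have "\<dots> = face11 A (face21 A w)"
    unfolding face21_def face10_def [symmetric]
    using free_G_map_compose [OF Pi(2) Pi(1) assms] by (simp add: face11_def)
  finally show ?thesis .
qed

end

context skb_morphism
begin

lemma G_morphism: "skb_morphism (free_G A) (free_G B) (free_G_map B h)"
  by (rule free_G_map_morphism [OF Pi])

lemma G2_morphism:
  "skb_morphism (free_G (free_G A)) (free_G (free_G B)) (free_G_map (free_G B) (free_G_map B h))"
  by (rule free_G_map_morphism [OF skb_morphism.Pi [OF G_morphism]])

lemma face10_natural:
  assumes "y \<in> carrier (free_G (free_G A))"
  shows "face10 B (free_G_map (free_G B) (free_G_map B h) y) = free_G_map B h (face10 A y)"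
  unfolding face10_def by (rule skb_morphism.counit_natural [OF G_morphism assms])

text \<open>The functor G applied to the naturality square of \<epsilon> at h.\<close>

lemma face11_natural:
  assumes "y \<in> carrier (free_G (free_G A))"
  shows "face11 B (free_G_map (free_G B) (free_G_map B h) y) = free_G_map B h (face11 A y)"
proof -
  note Ps = skb_morphism.Pi [OF G_morphism] skb_morphism.Pi [OF A.counit_morphism]
    skb_morphism.Pi [OF B.counit_morphism]
  have "face11 B (free_G_map (free_G B) (free_G_map B h) y) =
      free_G_map B (\<lambda>x. counit B (free_G_map B h x)) y"
    unfolding face11_def by (rule free_G_map_compose [OF Ps(1) Ps(3) assms])
  also have "\<dots> = free_G_map B (\<lambda>x. h (counit A x)) y"
    using Ps assms by (intro free_G_map_cong [where A = "free_G A"]) (auto simp: counit_natural)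
  also have "\<dots> = free_G_map B h (face11 A y)"
    unfolding face11_def by (rule free_G_map_compose [OF Ps(2) Pi assms, symmetric])
  finally show ?thesis .
qed

end

section \<open>Consequences of the homological hypotheses\<close>

lemma carrier_FactGroup: "carrier (G Mod H) = (\<lambda>c. H #>\<^bsub>G\<^esub> c) ` carrier G"
  by (auto simp: FactGroup_def RCOSETS_def)

section \<open>Chains, cycles and boundaries through representatives\<close>

context skew_brace
begin

lemma moore1_sub: "moore1 A \<subseteq> ab_class (free_G (free_G A)) ` carrier (free_G (free_G A))"
  unfolding moore1_def chain1_def chain0_def
  by (rule skb_morphism.ab_kernel_sub [OF face10_morphism])

lemma moore1_iff:
  "y \<in> carrier (free_G (free_G A)) \<Longrightarrow>
    ab_class (free_G (free_G A)) y \<in> moore1 A \<longleftrightarrow> face10 A y \<in> derived_ideal (free_G A)"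
  unfolding moore1_def chain1_def chain0_def
  by (rule skb_morphism.ab_kernel_iff [OF face10_morphism])

lemma cycles1_iff:
  "y \<in> carrier (free_G (free_G A)) \<Longrightarrow>
    ab_class (free_G (free_G A)) y \<in> cycles1 A \<longleftrightarrow>
    face10 A y \<in> derived_ideal (free_G A) \<and> face11 A y \<in> derived_ideal (free_G A)"
  unfolding cycles1_def Int_iff moore1_iff chain1_def chain0_def
  by (simp only: moore1_iff skb_morphism.ab_kernel_iff [OF face11_morphism])

lemma boundaries0_memI:
  assumes "y \<in> carrier (free_G (free_G A))" "face10 A y \<in> derived_ideal (free_G A)"
  shows "ab_class (free_G A) (face11 A y) \<in> boundaries0 A"
  unfolding boundaries0_def
  using assms moore1_iff skb_morphism.ab_map_class [OF face11_morphism assms(1)]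
  by (metis imageI)

lemma boundaries0_memE:
  assumes "X \<in> boundaries0 A"
  obtains y where "y \<in> carrier (free_G (free_G A))" "face10 A y \<in> derived_ideal (free_G A)"
    "X = ab_class (free_G A) (face11 A y)"
proof -
  obtain Y where Y: "Y \<in> moore1 A" "X = ab_map (free_G A) (face11 A) Y"
    using assms by (auto simp: boundaries0_def)
  then obtain y where y: "y \<in> carrier (free_G (free_G A))" "Y = ab_class (free_G (free_G A)) y"
    using moore1_sub by blast
  show thesis
    using that y Y moore1_iff skb_morphism.ab_map_class [OF face11_morphism y(1)] by blast
qed

lemma boundaries1_memE:
  assumes "X \<in> boundaries1 A"
  obtains w where "w \<in> carrier (free_G (free_G (free_G A)))"
    "face20 A w \<in> derived_ideal (free_G (free_G A))"
    "face21 A w \<in> derived_ideal (free_G (free_G A))"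
    "X = ab_class (free_G (free_G A)) (face22 A w)"
proof -
  let ?F = "free_G (free_G (free_G A))"
  obtain W where W: "W \<in> moore2 A" "X = ab_map (free_G (free_G A)) (face22 A) W"
    using assms by (auto simp: boundaries1_def)
  then obtain w where w: "w \<in> carrier ?F" "W = ab_class ?F w"
    using skb_morphism.ab_kernel_sub [OF face20_morphism]
    unfolding moore2_def chain2_def chain1_def by blast
  then have "face20 A w \<in> derived_ideal (free_G (free_G A))"
    "face21 A w \<in> derived_ideal (free_G (free_G A))"
    using W skb_morphism.ab_kernel_iff [OF face20_morphism w(1)]
      skb_morphism.ab_kernel_iff [OF face21_morphism w(1)]
    unfolding moore2_def chain2_def chain1_def by blast+
  then show thesis
    using that w W skb_morphism.ab_map_class [OF face22_morphism w(1)] by blast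
qed

text \<open>Puts every cycle into its own coset of \<open>boundaries1\<close>, which is how
  \<open>homology2_lift_class\<close> extracts an equation from an equality of cosets.\<close>

lemma zero_boundaries1: "ab_class (free_G (free_G A)) \<zero>\<^bsub>free_G (free_G A)\<^esub> \<in> boundaries1 A"
proof -
  interpret F2: skew_brace "free_G (free_G A)" by simp
  interpret F3: skew_brace "free_G (free_G (free_G A))" by simp
  interpret d0: skb_morphism "free_G (free_G (free_G A))" "free_G (free_G A)" "face20 A"
    by (rule face20_morphism)
  interpret d1: skb_morphism "free_G (free_G (free_G A))" "free_G (free_G A)" "face21 A"
    by (rule face21_morphism)
  interpret d2: skb_morphism "free_G (free_G (free_G A))" "free_G (free_G A)" "face22 A"
    by (rule face22_morphism)
  interpret D: skew_brace_ideal "derived_ideal (free_G (free_G A))" "free_G (free_G A)"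
    by (rule F2.derived_skew_brace_ideal)
  let ?z = "\<zero>\<^bsub>free_G (free_G (free_G A))\<^esub>"
  have "ab_class (free_G (free_G (free_G A))) ?z \<in> moore2 A"
    unfolding moore2_def chain2_def chain1_def
    by (simp add: d0.ab_kernel_iff d1.ab_kernel_iff)
  then have "ab_map (free_G (free_G A)) (face22 A) (ab_class (free_G (free_G (free_G A))) ?z)
      \<in> boundaries1 A"
    unfolding boundaries1_def by (rule imageI)
  then show ?thesis by (simp add: d2.ab_map_class)
qed

lemma boundaries0_subgroup: "subgroup (boundaries0 A) (chain0 A)"
proof -
  interpret d0: group_hom "chain1 A" "chain0 A" "ab_map (free_G A) (face10 A)"
    unfolding chain1_def chain0_def
    by (rule skb_morphism_group_hom [OF skb_morphism.ab_map_morphism [OF face10_morphism]])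
  interpret d1: group_hom "chain1 A" "chain0 A" "ab_map (free_G A) (face11 A)"
    unfolding chain1_def chain0_def
    by (rule skb_morphism_group_hom [OF skb_morphism.ab_map_morphism [OF face11_morphism]])
  show ?thesis
    unfolding boundaries0_def moore1_def
    by (rule d1.subgroup_img_is_subgroup [OF d0.subgroup_kernel])
qed

text \<open>Because \<epsilon> d1 = \<epsilon> d0 and d0 of the bounding chain is derived,
  boundaries die in ab(A). This is the augmentation from H_1(A) to ab(A).\<close>

lemma counit_boundaries0:
  assumes "X \<in> boundaries0 A"
  obtains y where "y \<in> carrier (free_G A)" "X = ab_class (free_G A) y"
    "counit A y \<in> derived_ideal A"
proof -
  obtain y where y: "y \<in> carrier (free_G (free_G A))" "face10 A y \<in> derived_ideal (free_G A)"
    "X = ab_class (free_G A) (face11 A y)"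
    using assms by (rule boundaries0_memE)
  interpret d1: skb_morphism "free_G (free_G A)" "free_G A" "face11 A"
    by (rule face11_morphism)
  have "counit A (face11 A y) \<in> derived_ideal A"
    using counit_face y skb_morphism.derived_ideal_hom [OF counit_morphism] by metis
  then show thesis using that [of "face11 A y"] y by simp
qed

lemma counit_surj: "counit A ` carrier (free_G A) = carrier A"
proof -
  interpret skb_morphism "free_G A" A "counit A" by (rule counit_morphism)
  show ?thesis
  proof (rule equalityI)
    show "carrier A \<subseteq> counit A ` carrier (free_G A)"
      using counit_gen free_gen_closed by (metis image_eqI subsetI)
  qed auto
qed

end

section \<open>Consequences of the isomorphism on H_1\<close>

context skb_morphism
begin

lemma G_ab_map_boundaries0:
  "ab_map (free_G B) (free_G_map B h) ` boundaries0 A \<subseteq> boundaries0 B"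
proof (rule image_subsetI)
  interpret G: skb_morphism "free_G A" "free_G B" "free_G_map B h" by (rule G_morphism)
  interpret G2: skb_morphism "free_G (free_G A)" "free_G (free_G B)"
    "free_G_map (free_G B) (free_G_map B h)" by (rule G2_morphism)
  interpret d1: skb_morphism "free_G (free_G A)" "free_G A" "face11 A"
    by (rule A.face11_morphism)
  fix X assume "X \<in> boundaries0 A"
  then obtain y where y: "y \<in> carrier (free_G (free_G A))"
    "face10 A y \<in> derived_ideal (free_G A)" "X = ab_class (free_G A) (face11 A y)"
    by (rule A.boundaries0_memE)
  then have "ab_map (free_G B) (free_G_map B h) X =
      ab_class (free_G B) (face11 B (free_G_map (free_G B) (free_G_map B h) y))"
    by (simp add: G.ab_map_class face11_natural)
  also have "\<dots> \<in> boundaries0 B"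
    using y by (intro B.boundaries0_memI) (simp_all add: face10_natural G.derived_ideal_hom)
  finally show "ab_map (free_G B) (free_G_map B h) X \<in> boundaries0 B" .
qed

text \<open>The generator on x represents the class of x. If h x lies in [B, B], the image of that
  class in H_1(B) is trivial; injectivity makes the generator itself a boundary, and the
  augmentation puts x into [A, A].\<close>

lemma homology1_injective:
  assumes H1: "homology1_map B h \<in> iso (homology1 A) (homology1 B)"
    and x: "x \<in> carrier A" and hx: "h x \<in> derived_ideal B"
  shows "x \<in> derived_ideal A"
proof -
  let ?k = "ab_map (free_G B) (free_G_map B h)"
  interpret FA: skew_brace "free_G A" by simp
  interpret FB: skew_brace "free_G B" by simp
  interpret G: skb_morphism "free_G A" "free_G B" "free_G_map B h" by (rule G_morphism)
  interpret eA: skb_morphism "free_G A" A "counit A" by (rule A.counit_morphism)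
  interpret eB: skb_morphism "free_G B" B "counit B" by (rule B.counit_morphism)
  interpret k: group_hom "chain0 A" "chain0 B" ?k
    unfolding chain0_def by (rule skb_morphism_group_hom [OF G.ab_map_morphism])
  interpret NA: subgroup "boundaries0 A" "chain0 A" by (rule A.boundaries0_subgroup)
  interpret NB: subgroup "boundaries0 B" "chain0 B" by (rule B.boundaries0_subgroup)
  have map: "homology1_map B h (boundaries0 A #>\<^bsub>chain0 A\<^esub> c) = boundaries0 B #>\<^bsub>chain0 B\<^esub> ?k c"
    if "c \<in> carrier (chain0 A)" for c
    unfolding homology1_map_def
    by (rule coset_map_r_coset [OF k.group_hom_axioms A.boundaries0_subgroup
          B.boundaries0_subgroup G_ab_map_boundaries0 that])
  let ?c = "ab_class (free_G A) (free_gen A x)"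
  have c: "?c \<in> carrier (chain0 A)" using x by (simp add: chain0_def FA.ab_carrier)
  have "counit B ` derived_ideal (free_G B) = derived_ideal B"
    by (rule eB.commutator_image_eq) (simp_all add: B.counit_surj)
  then obtain r where r: "r \<in> derived_ideal (free_G B)" "counit B r = h x"
    using hx by (metis imageE)
  then have rF: "r \<in> carrier (free_G B)"
    using skew_brace_ideal.sub_carrier [OF FB.derived_skew_brace_ideal] by blast
  \<comment> \<open>The degree one generator on r has d0 equal to the derived element r and d1 equal
    to the generator on h x, which is thereby a boundary.\<close>
  have "face10 B (free_gen (free_G B) r) = r"
    unfolding face10_def by (rule FB.counit_gen [OF rF])
  moreover have "face11 B (free_gen (free_G B) r) = free_gen B (h x)"
    unfolding face11_def using free_G_map_gen [OF eB.Pi rF] r by simp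
  ultimately have "ab_class (free_G B) (free_gen B (h x)) \<in> boundaries0 B"
    using B.boundaries0_memI [of "free_gen (free_G B) r"] r rF by simp
  moreover have "?k ?c = ab_class (free_G B) (free_gen B (h x))"
    using x by (simp add: G.ab_map_class free_G_map_gen [OF Pi])
  ultimately have kc: "?k ?c \<in> boundaries0 B" by simp
  \<comment> \<open>The class of \<open>?c\<close> and the neutral class have the same image, so
    injectivity identifies them.\<close>
  have "homology1_map B h (boundaries0 A #>\<^bsub>chain0 A\<^esub> ?c) = boundaries0 B"
    using map [OF c] k.H.coset_join2 [OF k.hom_closed [OF c] NB.subgroup_axioms kc] by simp
  moreover have "homology1_map B h (boundaries0 A #>\<^bsub>chain0 A\<^esub> \<one>\<^bsub>chain0 A\<^esub>) = boundaries0 B"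
    using map [OF k.G.one_closed] k.H.coset_join2 [OF k.H.one_closed NB.subgroup_axioms NB.one_closed]
    by simp
  moreover have "inj_on (homology1_map B h) (carrier (homology1 A))"
    using H1 by (auto simp: iso_def bij_betw_def)
  moreover have "boundaries0 A #>\<^bsub>chain0 A\<^esub> d \<in> carrier (homology1 A)" if "d \<in> carrier (chain0 A)" for d
    using that by (simp add: homology1_def carrier_FactGroup)
  ultimately have "boundaries0 A #>\<^bsub>chain0 A\<^esub> ?c = boundaries0 A #>\<^bsub>chain0 A\<^esub> \<one>\<^bsub>chain0 A\<^esub>"
    using c k.G.one_closed by (metis inj_onD)
  also have "\<dots> = boundaries0 A"
    by (rule k.G.coset_join2 [OF k.G.one_closed NA.subgroup_axioms NA.one_closed])
  finally have "?c \<in> boundaries0 A"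
    using k.G.rcos_self [OF c NA.subgroup_axioms] by simp
  then obtain y where y: "y \<in> carrier (free_G A)" "?c = ab_class (free_G A) y"
    "counit A y \<in> derived_ideal A"
    by (rule A.counit_boundaries0)
  have "ab_class A x = ab_class A (counit A y)"
    using eA.ab_class_hom [of "free_gen A x" y] x y by (simp add: A.counit_gen)
  also have "\<dots> = ab_class A \<zero>\<^bsub>A\<^esub>"
    using y by (simp add: A.ab_class_eq_zero)
  finally show ?thesis
    using x by (simp add: A.ab_class_eq_zero)
qed

text \<open>The class of the generator on b has a preimage, represented by some d; the witness a is
  the counit of a representative of d. The boundary that remains disappears under the
  augmentation.\<close>

lemma homology1_surjective:
  assumes H1: "homology1_map B h \<in> iso (homology1 A) (homology1 B)" and b: "b \<in> carrier B"
  shows "\<exists>a\<in>carrier A. ab_class B b = ab_class B (h a)"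
proof -
  let ?k = "ab_map (free_G B) (free_G_map B h)"
  interpret FA: skew_brace "free_G A" by simp
  interpret FB: skew_brace "free_G B" by simp
  interpret G: skb_morphism "free_G A" "free_G B" "free_G_map B h" by (rule G_morphism)
  interpret eA: skb_morphism "free_G A" A "counit A" by (rule A.counit_morphism)
  interpret eB: skb_morphism "free_G B" B "counit B" by (rule B.counit_morphism)
  interpret abB: skew_brace "ab B" by (rule B.ab_skew_brace)
  interpret k: group_hom "chain0 A" "chain0 B" ?k
    unfolding chain0_def by (rule skb_morphism_group_hom [OF G.ab_map_morphism])
  let ?c = "ab_class (free_G B) (free_gen B b)"
  have c: "?c \<in> carrier (chain0 B)" using b by (simp add: chain0_def FB.ab_carrier)
  then have "boundaries0 B #>\<^bsub>chain0 B\<^esub> ?c \<in> carrier (homology1 B)"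
    by (simp add: homology1_def carrier_FactGroup)
  moreover have "carrier (homology1 B) = homology1_map B h ` carrier (homology1 A)"
    using H1 by (auto simp: iso_def bij_betw_def)
  ultimately have "boundaries0 B #>\<^bsub>chain0 B\<^esub> ?c \<in>
      homology1_map B h ` (\<lambda>c. boundaries0 A #>\<^bsub>chain0 A\<^esub> c) ` carrier (chain0 A)"
    by (simp only: homology1_def carrier_FactGroup)
  then obtain d where d: "d \<in> carrier (chain0 A)"
    and eq: "boundaries0 B #>\<^bsub>chain0 B\<^esub> ?c = homology1_map B h (boundaries0 A #>\<^bsub>chain0 A\<^esub> d)"
    by (elim imageE) simp
  note eq
  also have "homology1_map B h (boundaries0 A #>\<^bsub>chain0 A\<^esub> d) = boundaries0 B #>\<^bsub>chain0 B\<^esub> ?k d"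
    unfolding homology1_map_def
    by (rule coset_map_r_coset [OF k.group_hom_axioms A.boundaries0_subgroup
          B.boundaries0_subgroup G_ab_map_boundaries0 d])
  finally have "?c \<in> boundaries0 B #>\<^bsub>chain0 B\<^esub> ?k d"
    using k.H.rcos_self [OF c B.boundaries0_subgroup] by simp
  then obtain X where X: "X \<in> boundaries0 B" "?c = X \<oplus>\<^bsub>ab (free_G B)\<^esub> ?k d"
    by (auto simp: r_coset_def chain0_def)
  obtain r where r: "r \<in> carrier (free_G A)" "d = ab_class (free_G A) r"
    using d by (auto simp: chain0_def FA.ab_carrier)
  obtain y where y: "y \<in> carrier (free_G B)" "X = ab_class (free_G B) y"
    "counit B y \<in> derived_ideal B"
    using X(1) by (rule B.counit_boundaries0)
  have "?c = ab_class (free_G B) (y \<oplus>\<^bsub>free_G B\<^esub> free_G_map B h r)"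
    using X y r by (simp add: G.ab_map_class FB.ab_add)
  then have "ab_class B b = ab_class B (counit B y \<oplus>\<^bsub>B\<^esub> h (counit A r))"
    using eB.ab_class_hom [of "free_gen B b" "y \<oplus>\<^bsub>free_G B\<^esub> free_G_map B h r"] b y r
    by (simp add: B.counit_gen counit_natural)
  also have "\<dots> = ab_class B (counit B y) \<oplus>\<^bsub>ab B\<^esub> ab_class B (h (counit A r))"
    using y r by (simp add: B.ab_add)
  also have "ab_class B (counit B y) = \<zero>\<^bsub>ab B\<^esub>"
    using y B.ab_class_eq_zero [of "counit B y"] by (simp add: B.ab_zero)
  finally show ?thesis
    using r by (intro bexI [of _ "counit A r"]) (simp_all add: B.ab_carrier)
qed

end

section \<open>The class of a cycle\<close>

text \<open>
  For a pair of maps \<open>d\<^sub>0, d\<^sub>1 : C \<rightarrow> F\<close> coequalized by \<open>e : F \<rightarrow> B\<close> with kernel \<open>R\<close>, the difference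
  \<open>d\<^sub>1 - d\<^sub>0\<close> takes values in \<open>R/[R,F]\<close>, which annihilates \<open>F/[R,F]\<close>; hence it is additive and vanishes
  on \<open>[C,C]\<close>. On cycles it is the comparison with the Hopf formula.
\<close>

locale augmented_pair =
  d0: skb_morphism C F d0 + d1: skb_morphism C F d1 + e: skb_morphism F B e
  for C :: "'c ring" and F :: "'f ring" and B :: "'b ring" and d0 d1 e +
  assumes coequal: "y \<in> carrier C \<Longrightarrow> e (d1 y) = e (d0 y)"
begin

definition "R = {z \<in> carrier F. e z = \<zero>\<^bsub>B\<^esub>}"

definition "\<pi> y = commutator_Ab R F +>\<^bsub>F\<^esub> y"

definition "\<delta> y = \<pi> (d1 y \<ominus>\<^bsub>F\<^esub> d0 y)"

abbreviation "Q \<equiv> F Quot commutator_Ab R F"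

sublocale R: skew_brace_ideal R F
  unfolding R_def using d0.B.skew_brace_idealI e.vimage_ideal [OF e.B.zero_ideal] by simp

sublocale \<pi>: skb_morphism F Q \<pi>
  unfolding \<pi>_def
  by (rule skew_brace_ideal.coset_morphism [OF d0.B.skew_brace_idealI [OF R.commutator_ideal]])

lemma \<delta>_annihilator: "y \<in> carrier C \<Longrightarrow> \<delta> y \<in> skb_annihilator Q"
  unfolding \<delta>_def \<pi>_def
proof (rule R.coset_annihilator)
  assume y: "y \<in> carrier C"
  then have "e (d1 y \<ominus>\<^bsub>F\<^esub> d0 y) = \<zero>\<^bsub>B\<^esub>"
    by (simp add: e.hom_minus coequal) (simp add: a_minus_def)
  moreover have "d1 y \<ominus>\<^bsub>F\<^esub> d0 y \<in> carrier F"
    using y by simp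
  ultimately show "d1 y \<ominus>\<^bsub>F\<^esub> d0 y \<in> R"
    unfolding R_def by blast
qed

lemma \<delta>_closed: "y \<in> carrier C \<Longrightarrow> \<delta> y \<in> carrier Q"
  by (simp add: \<delta>_def)

lemma \<delta>_eq: "y \<in> carrier C \<Longrightarrow> \<delta> y = \<pi> (d1 y) \<ominus>\<^bsub>Q\<^esub> \<pi> (d0 y)"
  by (simp add: \<delta>_def \<pi>.hom_minus)

lemma \<delta>_zero: "\<lbrakk>y \<in> carrier C; \<pi> (d1 y) = \<pi> (d0 y)\<rbrakk> \<Longrightarrow> \<delta> y = \<zero>\<^bsub>Q\<^esub>"
  by (simp add: \<delta>_eq a_minus_def)

lemma \<pi>_agree:
  assumes "y \<in> derived_ideal C" shows "\<pi> (d1 y) = \<pi> (d0 y)"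
proof (rule homs_agree_on_commutator [OF _ _ _ assms])
  show "skb_morphism C Q (\<lambda>y. \<pi> (d1 y))"
    by (rule skb_morphism_compose [OF \<pi>.skb_morphism_axioms d1.skb_morphism_axioms])
  show "skb_morphism C Q (\<lambda>y. \<pi> (d0 y))"
    by (rule skb_morphism_compose [OF \<pi>.skb_morphism_axioms d0.skb_morphism_axioms])
  fix y assume y: "y \<in> carrier C"
  then have "\<pi> (d1 y) = \<delta> y \<oplus>\<^bsub>Q\<^esub> \<pi> (d0 y)"
    by (simp add: \<delta>_eq a_minus_def)
  then show "\<exists>s\<in>skb_annihilator Q. \<pi> (d1 y) = s \<oplus>\<^bsub>Q\<^esub> \<pi> (d0 y)"
    using \<delta>_annihilator [OF y] by blast
qed

lemma \<delta>_add:
  assumes "a \<in> carrier C" "b \<in> carrier C"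
  shows "\<delta> (a \<oplus>\<^bsub>C\<^esub> b) = \<delta> a \<oplus>\<^bsub>Q\<^esub> \<delta> b"
proof -
  note swap = \<pi>.B.annihilatorD(2) [OF \<delta>_annihilator [OF assms(2)]]
  \<comment> \<open>Addition in Q may be noncommutative: \<delta> b arises between \<pi> (d1 a) and
    -\<pi> (d0 a), and only its centrality lets it leave that position.\<close>
  have "\<delta> (a \<oplus>\<^bsub>C\<^esub> b) = (\<pi> (d1 a) \<oplus>\<^bsub>Q\<^esub> \<delta> b) \<oplus>\<^bsub>Q\<^esub> \<ominus>\<^bsub>Q\<^esub> \<pi> (d0 a)"
    using assms
    by (simp add: \<delta>_eq a_minus_def \<pi>.B.add.inv_mult_group \<pi>.B.add.m_assoc)
  also have "\<pi> (d1 a) \<oplus>\<^bsub>Q\<^esub> \<delta> b = \<delta> b \<oplus>\<^bsub>Q\<^esub> \<pi> (d1 a)"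
    using assms by (intro swap) simp
  also have "\<dots> \<oplus>\<^bsub>Q\<^esub> \<ominus>\<^bsub>Q\<^esub> \<pi> (d0 a) = \<delta> b \<oplus>\<^bsub>Q\<^esub> \<delta> a"
    using assms \<delta>_closed [OF assms(2)] by (simp add: \<delta>_eq [OF assms(1)] a_minus_def \<pi>.B.add.m_assoc)
  also have "\<dots> = \<delta> a \<oplus>\<^bsub>Q\<^esub> \<delta> b"
    by (rule swap [OF \<delta>_closed [OF assms(1)], symmetric])
  finally show ?thesis .
qed

text \<open>Two representatives differ by an element of [C, C], on which \<delta> vanishes; so
  \<delta> factors through ab(C).\<close>

lemma \<delta>_ab_class:
  assumes ab: "a \<in> carrier C" "b \<in> carrier C" and eq: "ab_class C a = ab_class C b"
  shows "\<delta> a = \<delta> b"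
proof -
  interpret D: skew_brace_ideal "derived_ideal C" C
    by (rule d0.A.derived_skew_brace_ideal)
  obtain t where t: "t \<in> derived_ideal C" "b = t \<oplus>\<^bsub>C\<^esub> a"
    using D.coset_eq_iff [OF ab] eq by blast
  have "\<delta> b = \<delta> t \<oplus>\<^bsub>Q\<^esub> \<delta> a"
    unfolding t(2) by (rule \<delta>_add [OF D.sub_carrier [OF t(1)] ab(1)])
  also have "\<delta> t = \<zero>\<^bsub>Q\<^esub>"
    by (rule \<delta>_zero [OF D.sub_carrier [OF t(1)] \<pi>_agree [OF t(1)]])
  also have "\<zero>\<^bsub>Q\<^esub> \<oplus>\<^bsub>Q\<^esub> \<delta> a = \<delta> a"
    using \<delta>_closed [OF ab(1)] by simp
  finally show ?thesis by (rule HOL.sym)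
qed

end

lemma (in skew_brace) augmented_pair:
  "augmented_pair (free_G (free_G A)) (free_G A) A (face10 A) (face11 A) (counit A)"
  using face10_morphism face11_morphism counit_morphism counit_face
  by (simp add: augmented_pair_def augmented_pair_axioms_def)

section \<open>Lifting through the surjection on H_2\<close>

context skb_morphism
begin

text \<open>Unfolds surjectivity on H_2 down to representatives, to which \<delta> can be applied: w
  carries the boundary term and y the cycle of A.\<close>

lemma homology2_lift_class:
  assumes H2: "homology2_map B h ` carrier (homology2 A) = carrier (homology2 B)"
    and x: "x \<in> carrier (free_G (free_G B))"
    and x0: "face10 B x \<in> derived_ideal (free_G B)" and x1: "face11 B x \<in> derived_ideal (free_G B)"
  obtains w y where "w \<in> carrier (free_G (free_G (free_G B)))"
    "face20 B w \<in> derived_ideal (free_G (free_G B))"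
    "face21 B w \<in> derived_ideal (free_G (free_G B))"
    "y \<in> carrier (free_G (free_G A))"
    "face10 A y \<in> derived_ideal (free_G A)" "face11 A y \<in> derived_ideal (free_G A)"
    "ab_class (free_G (free_G B)) x = ab_class (free_G (free_G B))
      (face22 B w \<oplus>\<^bsub>free_G (free_G B)\<^esub> free_G_map (free_G B) (free_G_map B h) y)"
proof -
  let ?G2 = "free_G_map (free_G B) (free_G_map B h)"
  let ?k = "ab_map (free_G (free_G B)) ?G2"
  interpret A1: skew_brace "free_G A" by simp
  interpret A2: skew_brace "free_G (free_G A)" by simp
  interpret B2: skew_brace "free_G (free_G B)" by simp
  interpret abB2: skew_brace "ab (free_G (free_G B))" by (rule B2.ab_skew_brace)
  interpret G2: skb_morphism "free_G (free_G A)" "free_G (free_G B)" ?G2 by (rule G2_morphism)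
  interpret dA0: skb_morphism "free_G (free_G A)" "free_G A" "face10 A"
    by (rule A.face10_morphism)
  interpret dA1: skb_morphism "free_G (free_G A)" "free_G A" "face11 A"
    by (rule A.face11_morphism)
  interpret dA20: skb_morphism "free_G (free_G (free_G A))" "free_G (free_G A)" "face20 A"
    by (rule A.face20_morphism)
  interpret dA22: skb_morphism "free_G (free_G (free_G A))" "free_G (free_G A)" "face22 A"
    by (rule A.face22_morphism)
  interpret dB22: skb_morphism "free_G (free_G (free_G B))" "free_G (free_G B)" "face22 B"
    by (rule B.face22_morphism)
  interpret DA: subgroup "derived_ideal (free_G A)" "add_monoid (free_G A)"
    using A1.derived_ideal by (auto simp: skb_ideal_def normal_def)
  let ?x = "ab_class (free_G (free_G B)) x"
  have "?x \<in> cycles1 B" using x x0 x1 by (simp add: B.cycles1_iff)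
  then have "boundaries1 B #>\<^bsub>chain1 B\<^esub> ?x \<in> carrier (homology2 B)"
    by (simp add: homology2_def carrier_FactGroup r_coset_def)
  then obtain Y where "Y \<in> carrier (homology2 A)"
    and Y: "boundaries1 B #>\<^bsub>chain1 B\<^esub> ?x = homology2_map B h Y"
    unfolding H2 [symmetric] by (elim imageE) simp
  then obtain c where c: "c \<in> cycles1 A" "Y = boundaries1 A #>\<^bsub>chain1 A\<^esub> c"
    by (auto simp: homology2_def carrier_FactGroup r_coset_def)
  have "?x = ab_class (free_G (free_G B)) \<zero>\<^bsub>free_G (free_G B)\<^esub> \<oplus>\<^bsub>ab (free_G (free_G B))\<^esub> ?x"
    using x by (simp add: B2.ab_add)
  then have "?x \<in> boundaries1 B #>\<^bsub>chain1 B\<^esub> ?x"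
    using B.zero_boundaries1 by (auto simp: r_coset_def chain1_def)
  \<comment> \<open>The value of \<open>homology2_map\<close> at Y is a union over the members e of
    the coset Y, and such an e equals c only up to a boundary V.\<close>
  then have "?x \<in> (\<Union>e\<in>Y. boundaries1 B #>\<^bsub>chain1 B\<^esub> ?k e)"
    using Y by (simp add: homology2_map_def coset_map_def)
  then obtain e X where e: "e \<in> boundaries1 A #>\<^bsub>chain1 A\<^esub> c" and X: "X \<in> boundaries1 B"
    and xX: "?x = X \<oplus>\<^bsub>ab (free_G (free_G B))\<^esub> ?k e"
    using c by (auto simp: r_coset_def chain1_def)
  from e obtain V where V: "V \<in> boundaries1 A" "e = V \<oplus>\<^bsub>ab (free_G (free_G A))\<^esub> c"
    by (auto simp: r_coset_def chain1_def)
  obtain v where v: "v \<in> carrier (free_G (free_G (free_G A)))"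
    "face20 A v \<in> derived_ideal (free_G (free_G A))"
    "face21 A v \<in> derived_ideal (free_G (free_G A))"
    "V = ab_class (free_G (free_G A)) (face22 A v)"
    using V(1) by (rule A.boundaries1_memE)
  obtain w where w: "w \<in> carrier (free_G (free_G (free_G B)))"
    "face20 B w \<in> derived_ideal (free_G (free_G B))"
    "face21 B w \<in> derived_ideal (free_G (free_G B))"
    "X = ab_class (free_G (free_G B)) (face22 B w)"
    using X by (rule B.boundaries1_memE)
  have "c \<in> moore1 A" using c by (simp add: cycles1_def)
  then obtain y where y: "y \<in> carrier (free_G (free_G A))" "c = ab_class (free_G (free_G A)) y"
    using A.moore1_sub by blast
  then have y': "face10 A y \<in> derived_ideal (free_G A)" "face11 A y \<in> derived_ideal (free_G A)"
    using c by (simp_all add: A.cycles1_iff)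
  \<comment> \<open>The boundary V = d2 v is absorbed into the cycle. Its faces are d1 d0 v and d1
    d1 v, images of derived elements and hence derived.\<close>
  let ?y = "face22 A v \<oplus>\<^bsub>free_G (free_G A)\<^esub> y"
  have "e = ab_class (free_G (free_G A)) ?y"
    using V v y by (simp add: A2.ab_add)
  then have "?x = ab_class (free_G (free_G B)) (face22 B w \<oplus>\<^bsub>free_G (free_G B)\<^esub> ?G2 ?y)"
    using xX w y v by (simp add: G2.ab_map_class B2.ab_add)
  moreover have "face10 A ?y \<in> derived_ideal (free_G A)"
    using v y y' DA.m_closed [of "face11 A (face20 A v)" "face10 A y"]
    by (simp add: A.face10_face22 dA1.derived_ideal_hom)
  moreover have "face11 A ?y \<in> derived_ideal (free_G A)"
    using v y y' DA.m_closed [of "face11 A (face21 A v)" "face11 A y"]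
    by (simp add: A.face11_face22 dA1.derived_ideal_hom)
  moreover have "?y \<in> carrier (free_G (free_G A))" using y v by simp
  ultimately show thesis using that w(1-3) by blast
qed

text \<open>This is surjectivity between the Hopf quotients (R \<inter> [F, F])/[R, F]. It is
  obtained by realizing z as \<delta> of a cycle, lifting that cycle to A, and taking the difference
  of faces of the lift.\<close>

lemma homology2_lift:
  assumes H2: "homology2_map B h ` carrier (homology2 A) = carrier (homology2 B)"
    and z: "z \<in> derived_ideal (free_G B)" "counit B z = \<zero>\<^bsub>B\<^esub>"
  obtains r where "r \<in> derived_ideal (free_G A)" "counit A r = \<zero>\<^bsub>A\<^esub>"
    "commutator_Ab {z \<in> carrier (free_G B). counit B z = \<zero>\<^bsub>B\<^esub>} (free_G B) +>\<^bsub>free_G B\<^esub>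
      free_G_map B h r =
     commutator_Ab {z \<in> carrier (free_G B). counit B z = \<zero>\<^bsub>B\<^esub>} (free_G B) +>\<^bsub>free_G B\<^esub> z"
proof -
  let ?G2 = "free_G_map (free_G B) (free_G_map B h)"
  interpret pA: augmented_pair "free_G (free_G A)" "free_G A" A "face10 A" "face11 A" "counit A"
    by (rule A.augmented_pair)
  interpret pB: augmented_pair "free_G (free_G B)" "free_G B" B "face10 B" "face11 B" "counit B"
    by (rule B.augmented_pair)
  interpret G: skb_morphism "free_G A" "free_G B" "free_G_map B h" by (rule G_morphism)
  note G2_closed = skb_morphism.Pi [OF G2_morphism, THEN funcset_mem]
  note face22_closed = skb_morphism.Pi [OF B.face22_morphism, THEN funcset_mem]
  have DA: "subgroup (derived_ideal (free_G A)) (add_monoid (free_G A))"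
    using pA.d0.B.derived_ideal by (simp add: skb_ideal_def normal_def)
  have DB: "subgroup (derived_ideal (free_G B)) (add_monoid (free_G B))"
    using pB.d0.B.derived_ideal by (simp add: skb_ideal_def normal_def)
  have zF: "z \<in> carrier (free_G B)" using subgroup.mem_carrier [OF DB z(1)] by simp
  \<comment> \<open>Built so that d0 x = -z and, because \<epsilon> z = 0, also d1 x = 0. Hence d1 x
    - d0 x = z, and x is a cycle since z is derived.\<close>
  define x where "x = \<ominus>\<^bsub>free_G (free_G B)\<^esub> free_gen (free_G B) z
    \<oplus>\<^bsub>free_G (free_G B)\<^esub> free_gen (free_G B) \<zero>\<^bsub>free_G B\<^esub>"
  have xF: "x \<in> carrier (free_G (free_G B))" using zF by (simp add: x_def)
  have "face10 B (free_gen (free_G B) y) = y" if "y \<in> carrier (free_G B)" for y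
    unfolding face10_def by (rule pB.d0.B.counit_gen [OF that])
  then have x0: "face10 B x = \<ominus>\<^bsub>free_G B\<^esub> z"
    using zF by (simp add: x_def)
  have "face11 B (free_gen (free_G B) y) = free_gen B (counit B y)" if "y \<in> carrier (free_G B)" for y
    unfolding face11_def by (rule free_G_map_gen [OF pB.e.Pi that])
  then have x1: "face11 B x = \<zero>\<^bsub>free_G B\<^esub>"
    using zF z by (simp add: x_def)
  have "face10 B x \<in> derived_ideal (free_G B)"
    using subgroup.m_inv_closed [OF DB z(1)] by (simp add: x0 a_inv_def)
  moreover have "face11 B x \<in> derived_ideal (free_G B)"
    using subgroup.one_closed [OF DB] by (simp add: x1)
  ultimately obtain w y where w: "w \<in> carrier (free_G (free_G (free_G B)))"
    "face20 B w \<in> derived_ideal (free_G (free_G B))"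
    "face21 B w \<in> derived_ideal (free_G (free_G B))"
    and y: "y \<in> carrier (free_G (free_G A))"
    "face10 A y \<in> derived_ideal (free_G A)" "face11 A y \<in> derived_ideal (free_G A)"
    and xwy: "ab_class (free_G (free_G B)) x = ab_class (free_G (free_G B))
      (face22 B w \<oplus>\<^bsub>free_G (free_G B)\<^esub> ?G2 y)"
    by (rule homology2_lift_class [OF H2 xF])
  \<comment> \<open>The boundary term contributes nothing: under \<pi> the faces d0 and d1 agree on
    the derived elements d1 w and d0 w, and the simplicial identities link these equations.\<close>
  have "pB.\<pi> (face11 B (face22 B w)) = pB.\<pi> (face11 B (face21 B w))"
    using w by (simp add: B.face11_face22)
  also have "\<dots> = pB.\<pi> (face10 B (face21 B w))" by (rule pB.\<pi>_agree [OF w(3)])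
  also have "\<dots> = pB.\<pi> (face10 B (face20 B w))" using w by (simp add: B.face10_face21)
  also have "\<dots> = pB.\<pi> (face11 B (face20 B w))" by (rule pB.\<pi>_agree [OF w(2), symmetric])
  also have "\<dots> = pB.\<pi> (face10 B (face22 B w))" using w by (simp add: B.face10_face22)
  finally have \<delta>w: "pB.\<delta> (face22 B w) = \<zero>\<^bsub>pB.Q\<^esub>"
    by (rule pB.\<delta>_zero [OF face22_closed [OF w(1)]])
  \<comment> \<open>The difference of faces for A, taken before any quotient:
    \<open>counit_face\<close> puts it into ker \<epsilon>, and the cycle conditions make it
    derived.\<close>
  define r where "r = face11 A y \<ominus>\<^bsub>free_G A\<^esub> face10 A y"
  have "pB.\<pi> z = pB.\<delta> x"
    using zF by (simp add: pB.\<delta>_def x0 x1 a_minus_def)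
  also have "\<dots> = pB.\<delta> (face22 B w \<oplus>\<^bsub>free_G (free_G B)\<^esub> ?G2 y)"
    using face22_closed [OF w(1)] G2_closed [OF y(1)] xF by (intro pB.\<delta>_ab_class xwy) auto
  also have "\<dots> = pB.\<delta> (face22 B w) \<oplus>\<^bsub>pB.Q\<^esub> pB.\<delta> (?G2 y)"
    by (rule pB.\<delta>_add [OF face22_closed [OF w(1)] G2_closed [OF y(1)]])
  also have "\<dots> = pB.\<delta> (?G2 y)"
    using pB.\<delta>_closed [OF G2_closed [OF y(1)]] by (simp add: \<delta>w)
  also have "\<dots> = pB.\<pi> (free_G_map B h r)"
    using y by (simp add: pB.\<delta>_def r_def G.hom_minus face10_natural face11_natural)
  finally have "pB.\<pi> (free_G_map B h r) = pB.\<pi> z" by (rule HOL.sym)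
  moreover have "counit A r = \<zero>\<^bsub>A\<^esub>"
    using y by (simp add: r_def pA.e.hom_minus A.counit_face) (simp add: a_minus_def)
  moreover have "r \<in> derived_ideal (free_G A)"
    using subgroup.m_closed [OF DA y(3) subgroup.m_inv_closed [OF DA y(2)]]
    by (simp add: r_def a_minus_def a_inv_def)
  ultimately show thesis using that unfolding pB.\<pi>_def pB.R_def by blast
qed

end

section \<open>The lower central series\<close>

lemma (in skew_brace) commutator_mono:
  assumes "I \<subseteq> J" shows "commutator_Ab I A \<subseteq> commutator_Ab J A"
  unfolding commutator_Ab_def using assms by (intro add.mono_generate UN_mono) auto

lemma (in skew_brace) lower_central_ideal: "skb_ideal (lower_central A n) A"
proof (induction n)
  case 0
  then show ?case by (simp add: carrier_ideal)
next
  case (Suc n)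
  then show ?case
    using skew_brace_ideal.commutator_ideal [OF skew_brace_idealI] by simp
qed

lemma (in skew_brace) lower_central_Suc_sub: "lower_central A (Suc n) \<subseteq> lower_central A n"
  using skew_brace_ideal.commutator_sub [OF skew_brace_idealI [OF lower_central_ideal]] by simp

lemma (in skew_brace) lower_central_sub: "lower_central A n \<subseteq> carrier A"
  using skew_brace_ideal.sub_carrier [OF skew_brace_idealI [OF lower_central_ideal]] by blast

lemma (in skb_morphism) lower_central_image: "h ` lower_central A n \<subseteq> lower_central B n"
proof (induction n)
  case 0
  then show ?case by auto
next
  case (Suc n)
  then show ?case
    using commutator_image [OF A.lower_central_sub B.lower_central_sub] by simp
qed

lemma (in skew_brace_ideal) coset_eq_iff_minus:
  assumes "a \<in> carrier A" "b \<in> carrier A"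
  shows "I +> a = I +> b \<longleftrightarrow> b \<ominus> a \<in> I"
proof
  assume "I +> a = I +> b"
  then obtain x where "x \<in> I" "b = x \<oplus> a" using coset_eq_iff assms by blast
  then show "b \<ominus> a \<in> I" using assms by (simp add: a_minus_def sub_carrier)
next
  assume "b \<ominus> a \<in> I"
  moreover have "b = (b \<ominus> a) \<oplus> a" using assms by (simp add: a_minus_def)
  ultimately show "I +> a = I +> b" using coset_eq_iff assms by blast
qed

section \<open>Surjectivity modulo the lower central series\<close>

context skb_morphism
begin

text \<open>Modulo [M, B], with M = B^(n+1), the elements of M annihilate. A generator of M formed
  from i and y therefore keeps its class when i and y are replaced by h a and h c congruent to them
  modulo M, and it becomes the image of a generator of A^(n+1).\<close>

lemma lower_central_lift_step:
  assumes S: "\<And>b. b \<in> lower_central B n \<Longrightarrow>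
      \<exists>a\<in>lower_central A n. lower_central B (Suc n) +>\<^bsub>B\<^esub> b = lower_central B (Suc n) +>\<^bsub>B\<^esub> h a"
    and T: "\<And>b. b \<in> carrier B \<Longrightarrow>
      \<exists>a\<in>carrier A. lower_central B (Suc n) +>\<^bsub>B\<^esub> b = lower_central B (Suc n) +>\<^bsub>B\<^esub> h a"
    and b: "b \<in> lower_central B (Suc n)"
  shows "\<exists>a\<in>lower_central A (Suc n).
      lower_central B (Suc (Suc n)) +>\<^bsub>B\<^esub> b = lower_central B (Suc (Suc n)) +>\<^bsub>B\<^esub> h a"
proof -
  define M where "M = lower_central B (Suc n)"
  define N where "N = lower_central B (Suc (Suc n))"
  have N_eq: "N = commutator_Ab M B" by (simp add: N_def M_def)
  have M_eq: "M = commutator_Ab (lower_central B n) B" by (simp add: M_def)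
  interpret L: skew_brace_ideal "lower_central A n" A
    by (rule A.skew_brace_idealI [OF A.lower_central_ideal])
  interpret M: skew_brace_ideal M B
    unfolding M_def by (rule B.skew_brace_idealI [OF B.lower_central_ideal])
  interpret N: skew_brace_ideal N B
    unfolding N_def by (rule B.skew_brace_idealI [OF B.lower_central_ideal])
  let ?Q = "B Quot N" and ?p = "\<lambda>x. N +>\<^bsub>B\<^esub> x"
  interpret p: skb_morphism B ?Q ?p by (rule N.coset_morphism)
  have sub: "subgroup (lower_central A (Suc n)) (add_monoid A)"
    using A.lower_central_ideal [of "Suc n"] unfolding skb_ideal_def normal_def by blast
  have ann: "\<exists>s\<in>skb_annihilator ?Q. ?p y = s \<oplus>\<^bsub>?Q\<^esub> ?p (h a)"
    if ya: "y \<in> carrier B" "a \<in> carrier A" "M +>\<^bsub>B\<^esub> y = M +>\<^bsub>B\<^esub> h a" for y a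
  proof -
    have "M +>\<^bsub>B\<^esub> h a = M +>\<^bsub>B\<^esub> y" using ya(3) by (rule HOL.sym)
    then obtain k where k: "k \<in> M" "y = k \<oplus>\<^bsub>B\<^esub> h a"
      using ya(1,2) M.coset_eq_iff [of "h a" y] by auto
    have "?p k \<in> skb_annihilator ?Q"
      unfolding N_eq by (rule M.coset_annihilator [OF k(1)])
    moreover have "?p y = ?p k \<oplus>\<^bsub>?Q\<^esub> ?p (h a)"
      unfolding k(2) by (rule p.add.hom_mult [OF M.sub_carrier [OF k(1)]]) (simp add: ya)
    ultimately show ?thesis by blast
  qed
  \<comment> \<open>The liftable elements; once they contain the generators of M and form a
    subgroup, they contain M.\<close>
  define U where "U = {y \<in> carrier B. \<exists>a\<in>lower_central A (Suc n). ?p y = ?p (h a)}"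
  have comm: "add_commutator B i y \<in> U \<and> star B i y \<in> U \<and> circ_commutator B i y \<in> U"
    if i: "i \<in> lower_central B n" and y: "y \<in> carrier B" for i y
  proof -
    have iB: "i \<in> carrier B" using i B.lower_central_sub by blast
    obtain a where a: "a \<in> lower_central A n" "M +>\<^bsub>B\<^esub> i = M +>\<^bsub>B\<^esub> h a"
      using S [OF i] unfolding M_def by blast
    have aA: "a \<in> carrier A" by (rule L.sub_carrier [OF a(1)])
    obtain c where c: "c \<in> carrier A" "M +>\<^bsub>B\<^esub> y = M +>\<^bsub>B\<^esub> h c"
      using T [OF y] unfolding M_def by blast
    obtain s where s: "s \<in> skb_annihilator ?Q" "?p i = s \<oplus>\<^bsub>?Q\<^esub> ?p (h a)"
      using ann [OF iB aA a(2)] by blast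
    obtain t where t: "t \<in> skb_annihilator ?Q" "?p y = t \<oplus>\<^bsub>?Q\<^esub> ?p (h c)"
      using ann [OF y c] by blast
    have "?p (add_commutator B i y) = ?p (h (add_commutator A a c))"
      "?p (star B i y) = ?p (h (star A a c))"
      "?p (circ_commutator B i y) = ?p (h (circ_commutator A a c))"
      using iB aA y c(1) s t p.B.annihilatorD(1) [OF t(1)]
      by (simp_all add: p.hom_add_commutator p.hom_star p.hom_circ_commutator
          hom_add_commutator hom_star hom_circ_commutator
          p.B.annihilator_shift_left p.B.annihilator_shift_right)
    then show ?thesis
      using L.commutator_gen [OF a(1) c(1)] iB y by (auto simp: U_def)
  qed
  have "subgroup U (add_monoid B)"
  proof (rule B.add.subgroupI)
    show "U \<noteq> {}"
      using subgroup.one_closed [OF sub] by (auto simp: U_def intro!: exI [of _ "\<zero>\<^bsub>B\<^esub>"]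
          bexI [of _ "\<zero>\<^bsub>A\<^esub>"])
    fix y assume "y \<in> U"
    then obtain a where a: "y \<in> carrier B" "a \<in> lower_central A (Suc n)" "?p y = ?p (h a)"
      by (auto simp: U_def)
    have aA: "a \<in> carrier A" using a(2) A.lower_central_sub by blast
    have "\<ominus>\<^bsub>A\<^esub> a \<in> lower_central A (Suc n)"
      using subgroup.m_inv_closed [OF sub a(2)] by (simp add: a_inv_def)
    moreover have "?p (\<ominus>\<^bsub>B\<^esub> y) = ?p (h (\<ominus>\<^bsub>A\<^esub> a))" using a aA by simp
    ultimately show "\<ominus>\<^bsub>B\<^esub> y \<in> U" using a(1) unfolding U_def by blast
    fix z assume "z \<in> U"
    then obtain c where c: "z \<in> carrier B" "c \<in> lower_central A (Suc n)" "?p z = ?p (h c)"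
      by (auto simp: U_def)
    have cA: "c \<in> carrier A" using c(2) A.lower_central_sub by blast
    have "a \<oplus>\<^bsub>A\<^esub> c \<in> lower_central A (Suc n)"
      using subgroup.m_closed [OF sub a(2) c(2)] by simp
    moreover have "?p (y \<oplus>\<^bsub>B\<^esub> z) = ?p (h (a \<oplus>\<^bsub>A\<^esub> c))" using a aA c cA by simp
    ultimately show "y \<oplus>\<^bsub>B\<^esub> z \<in> U" using a(1) c(1) unfolding U_def by blast
  qed (auto simp: U_def)
  then have "M \<subseteq> U"
    unfolding M_eq commutator_Ab_def using comm
    by (intro B.add.generate_subgroup_incl) blast+
  then have "b \<in> U" using b unfolding M_def by blast
  then show ?thesis unfolding U_def N_def by blast
qed

text \<open>The two halves need each other: the second at n corrects a lift modulo B^n to one modulo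
  B^(n+1), and this new first half together with the second at n feeds
  \<open>lower_central_lift_step\<close>.\<close>

lemma lower_central_lift:
  assumes base: "\<And>b. b \<in> carrier B \<Longrightarrow> \<exists>a\<in>carrier A. ab_class B b = ab_class B (h a)"
  shows "(\<forall>b\<in>carrier B. \<exists>a\<in>carrier A. lower_central B n +>\<^bsub>B\<^esub> b = lower_central B n +>\<^bsub>B\<^esub> h a) \<and>
    (\<forall>b\<in>lower_central B n. \<exists>a\<in>lower_central A n.
      lower_central B (Suc n) +>\<^bsub>B\<^esub> b = lower_central B (Suc n) +>\<^bsub>B\<^esub> h a)"
proof (induction n)
  case 0
  interpret T: skew_brace_ideal "carrier B" B
    by (rule B.skew_brace_idealI [OF B.carrier_ideal])
  \<comment> \<open>Modulo B^0 = B there is a single coset, so 0 serves as witness. The second half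
    for n = 0 is \<open>base\<close>, as B^1 is the derived ideal.\<close>
  have "\<exists>a\<in>carrier A. carrier B +>\<^bsub>B\<^esub> b = carrier B +>\<^bsub>B\<^esub> h a" if "b \<in> carrier B" for b
  proof
    show "carrier B +>\<^bsub>B\<^esub> b = carrier B +>\<^bsub>B\<^esub> h \<zero>\<^bsub>A\<^esub>"
      using that T.coset_eq_iff_minus [of b "h \<zero>\<^bsub>A\<^esub>"] by simp
  qed simp
  then show ?case unfolding lower_central.simps using base by blast
next
  case (Suc n)
  interpret L: skew_brace_ideal "lower_central B n" B
    by (rule B.skew_brace_idealI [OF B.lower_central_ideal])
  interpret M: skew_brace_ideal "lower_central B (Suc n)" B
    by (rule B.skew_brace_idealI [OF B.lower_central_ideal])
  have T: "\<exists>a\<in>carrier A. lower_central B (Suc n) +>\<^bsub>B\<^esub> b = lower_central B (Suc n) +>\<^bsub>B\<^esub> h a"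
    if b: "b \<in> carrier B" for b
  proof -
    obtain a where a: "a \<in> carrier A" "lower_central B n +>\<^bsub>B\<^esub> b = lower_central B n +>\<^bsub>B\<^esub> h a"
      using Suc b by blast
    have "lower_central B n +>\<^bsub>B\<^esub> h a = lower_central B n +>\<^bsub>B\<^esub> b" using a(2) by (rule HOL.sym)
    then obtain k where k: "k \<in> lower_central B n" "b = k \<oplus>\<^bsub>B\<^esub> h a"
      using a(1) b L.coset_eq_iff [of "h a" b] by auto
    obtain c where c: "c \<in> lower_central A n"
      "lower_central B (Suc n) +>\<^bsub>B\<^esub> k = lower_central B (Suc n) +>\<^bsub>B\<^esub> h c"
      using Suc k by blast
    have cA: "c \<in> carrier A" using c(1) A.lower_central_sub by blast
    have "lower_central B (Suc n) +>\<^bsub>B\<^esub> b = lower_central B (Suc n) +>\<^bsub>B\<^esub> h (c \<oplus>\<^bsub>A\<^esub> a)"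
      using a(1) cA k(1) c(2) M.quot_add [of k "h a"] M.quot_add [of "h c" "h a"]
      by (simp add: k(2) L.sub_carrier del: lower_central.simps)
    then show ?thesis using a(1) cA by blast
  qed
  show ?case
    using T lower_central_lift_step [of n, OF _ T] Suc by blast
qed

end

text \<open>Uniqueness in the universal property of the free skew brace, by induction on a term
  representing P.\<close>

lemma free_hom_eqI:
  assumes u: "skb_morphism (free_G A) Q u" and v: "skb_morphism (free_G A) Q v"
    and gen: "\<And>a. a \<in> carrier A \<Longrightarrow> u (free_gen A a) = v (free_gen A a)"
    and P: "P \<in> carrier (free_G A)"
  shows "u P = v P"
proof -
  interpret u: skb_morphism "free_G A" Q u by (rule u)
  interpret v: skb_morphism "free_G A" Q v by (rule v)
  let ?cl = "skb_class (carrier A)"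
  have closed: "?cl t \<in> carrier (free_G A)" if "t \<in> skb_terms (carrier A)" for t
    using that by (simp add: free_G_def free_carrier)
  note cl = free_zero [of "carrier A", symmetric] free_one [of "carrier A", symmetric]
    free_add [of _ "carrier A", symmetric] free_circ [of _ "carrier A", symmetric]
    free_neg [of _ "carrier A", symmetric] free_inv [of _ "carrier A", symmetric]
  have "u (?cl t) = v (?cl t)" if "t \<in> skb_terms (carrier A)" for t
    using that
  proof (induction t)
    case (Gen a)
    then show ?case by (simp add: gen)
  qed (simp_all add: cl [folded free_G_def] closed del: u.A.one_eq_zero)
  then show ?thesis using P by (auto elim: free_G_cases)
qed

section \<open>Injectivity modulo the lower central series\<close>

context skb_morphism
begin

text \<open>\<open>surj\<close> and \<open>inj\<close> together make A/A^n \<rightarrow> B/B^n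
  bijective. That x lies in [A, A] gives it a derived lift, on which homomorphisms congruent modulo
  \<open>SA\<close> agree modulo \<open>KA\<close>.\<close>

lemma lower_central_injective_step:
  assumes H2: "homology2_map B h ` carrier (homology2 A) = carrier (homology2 B)"
    and surj: "\<And>b. b \<in> carrier B \<Longrightarrow>
      \<exists>a\<in>carrier A. lower_central B n +>\<^bsub>B\<^esub> b = lower_central B n +>\<^bsub>B\<^esub> h a"
    and inj: "\<And>a. \<lbrakk>a \<in> carrier A; h a \<in> lower_central B n\<rbrakk> \<Longrightarrow> a \<in> lower_central A n"
    and x: "x \<in> derived_ideal A" "h x \<in> lower_central B (Suc n)"
  shows "x \<in> lower_central A (Suc n)"
proof -
  define SA where "SA = {z \<in> carrier (free_G A). counit A z \<in> lower_central A n}"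
  define SB where "SB = {z \<in> carrier (free_G B). counit B z \<in> lower_central B n}"
  define KA where "KA = commutator_Ab SA (free_G A)"
  define KB where "KB = commutator_Ab SB (free_G B)"
  interpret eA: skb_morphism "free_G A" A "counit A" by (rule A.counit_morphism)
  interpret eB: skb_morphism "free_G B" B "counit B" by (rule B.counit_morphism)
  interpret G: skb_morphism "free_G A" "free_G B" "free_G_map B h" by (rule G_morphism)
  interpret LB: skew_brace_ideal "lower_central B n" B
    by (rule B.skew_brace_idealI [OF B.lower_central_ideal])
  interpret SA: skew_brace_ideal SA "free_G A"
    unfolding SA_def by (rule eA.A.skew_brace_idealI [OF eA.vimage_ideal [OF A.lower_central_ideal]])
  interpret SB: skew_brace_ideal SB "free_G B"
    unfolding SB_def by (rule eB.A.skew_brace_idealI [OF eB.vimage_ideal [OF B.lower_central_ideal]])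
  interpret KA: skew_brace_ideal KA "free_G A"
    unfolding KA_def by (rule eA.A.skew_brace_idealI [OF SA.commutator_ideal])
  interpret KB: skew_brace_ideal KB "free_G B"
    unfolding KB_def by (rule eB.A.skew_brace_idealI [OF SB.commutator_ideal])
  interpret pA: skb_morphism "free_G A" "free_G A Quot KA" "\<lambda>y. KA +>\<^bsub>free_G A\<^esub> y"
    by (rule KA.coset_morphism)

  \<comment> \<open>A mere function choosing preimages modulo B^n; as G(B) is free, it extends to
    the homomorphism g.\<close>
  have "\<exists>c. \<forall>b\<in>carrier B. c b \<in> carrier A \<and>
      lower_central B n +>\<^bsub>B\<^esub> b = lower_central B n +>\<^bsub>B\<^esub> h (c b)"
    by (rule bchoice) (use surj in blast)
  then obtain c where c: "c b \<in> carrier A \<and>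
      lower_central B n +>\<^bsub>B\<^esub> b = lower_central B n +>\<^bsub>B\<^esub> h (c b)" if "b \<in> carrier B" for b
    by blast
  have c_Pi: "c \<in> carrier B \<rightarrow> carrier A" using c by blast
  define g where "g = free_G_map A c"
  interpret g: skb_morphism "free_G B" "free_G A" g
    unfolding g_def by (rule free_G_map_morphism [OF c_Pi])
  have over: "lower_central B n +>\<^bsub>B\<^esub> h (counit A (g y)) = lower_central B n +>\<^bsub>B\<^esub> counit B y"
    if y: "y \<in> carrier (free_G B)" for y
  proof (rule free_hom_eqI [OF _ _ _ y])
    show "skb_morphism (free_G B) (B Quot lower_central B n)
        (\<lambda>y. lower_central B n +>\<^bsub>B\<^esub> h (counit A (g y)))"
      by (rule skb_morphism_compose [OF LB.coset_morphism skb_morphism_compose [OF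
          skb_morphism_axioms skb_morphism_compose [OF eA.skb_morphism_axioms g.skb_morphism_axioms]]])
    show "skb_morphism (free_G B) (B Quot lower_central B n)
        (\<lambda>y. lower_central B n +>\<^bsub>B\<^esub> counit B y)"
      by (rule skb_morphism_compose [OF LB.coset_morphism eB.skb_morphism_axioms])
    fix b assume b: "b \<in> carrier B"
    have "counit A (g (free_gen B b)) = c b"
      using c [OF b] by (simp add: g_def free_G_map_gen [OF c_Pi b] A.counit_gen)
    then show "lower_central B n +>\<^bsub>B\<^esub> h (counit A (g (free_gen B b))) =
        lower_central B n +>\<^bsub>B\<^esub> counit B (free_gen B b)"
      using c [OF b] by (simp add: B.counit_gen [OF b])
  qed

  \<comment> \<open>By \<open>over\<close>, h (\<epsilon> (g y)) lies in B^n when \<epsilon> y does,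
    and \<open>inj\<close> brings this back to A^n. Hence g maps the commutator ideal
    \<open>KB\<close> into \<open>KA\<close>.\<close>
  have "g ` SB \<subseteq> SA"
  proof (rule image_subsetI)
    fix y assume y: "y \<in> SB"
    then have yF: "y \<in> carrier (free_G B)" and "counit B y \<in> lower_central B n"
      by (simp_all only: SB_def mem_Collect_eq)
    then have "h (counit A (g y)) \<in> lower_central B n"
      using over [OF yF] LB.coset_eq_zero_iff [of "counit B y"]
        LB.coset_eq_zero_iff [of "h (counit A (g y))"] by simp
    then have "counit A (g y) \<in> lower_central A n" using yF by (intro inj) simp
    then show "g y \<in> SA" using yF unfolding SA_def by simp
  qed
  then have gK: "g ` KB \<subseteq> KA"
    unfolding KA_def KB_def using SA.sub_carrier SB.sub_carrier
    by (intro g.commutator_image) auto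

  \<comment> \<open>The two homomorphisms differ by elements of \<open>SA\<close>, again by
    \<open>over\<close> and \<open>inj\<close>, and these annihilate modulo
    \<open>KA\<close>.\<close>
  have agree: "KA +>\<^bsub>free_G A\<^esub> g (free_G_map B h y) = KA +>\<^bsub>free_G A\<^esub> y"
    if "y \<in> derived_ideal (free_G A)" for y
  proof (rule homs_agree_on_commutator [OF _ pA.skb_morphism_axioms _ that])
    show "skb_morphism (free_G A) (free_G A Quot KA) (\<lambda>y. KA +>\<^bsub>free_G A\<^esub> g (free_G_map B h y))"
      by (rule skb_morphism_compose [OF pA.skb_morphism_axioms
            skb_morphism_compose [OF g.skb_morphism_axioms G.skb_morphism_axioms]])
    fix y assume y: "y \<in> carrier (free_G A)"
    let ?y = "g (free_G_map B h y)"
    have "lower_central B n +>\<^bsub>B\<^esub> h (counit A ?y) = lower_central B n +>\<^bsub>B\<^esub> h (counit A y)"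
      using over [of "free_G_map B h y"] y by (simp add: counit_natural)
    then have "h (counit A y) \<ominus>\<^bsub>B\<^esub> h (counit A ?y) \<in> lower_central B n"
      using LB.coset_eq_iff_minus y by simp
    then have "h (counit A (y \<ominus>\<^bsub>free_G A\<^esub> ?y)) \<in> lower_central B n"
      using y by (simp add: eA.hom_minus hom_minus)
    then have "y \<ominus>\<^bsub>free_G A\<^esub> ?y \<in> SA"
      unfolding SA_def using y by (simp add: inj)
    then have "\<ominus>\<^bsub>free_G A\<^esub> (y \<ominus>\<^bsub>free_G A\<^esub> ?y) \<in> SA" by simp
    then have "KA +>\<^bsub>free_G A\<^esub> \<ominus>\<^bsub>free_G A\<^esub> (y \<ominus>\<^bsub>free_G A\<^esub> ?y) \<in> skb_annihilator (free_G A Quot KA)"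
      unfolding KA_def by (rule SA.coset_annihilator)
    moreover have "?y = \<ominus>\<^bsub>free_G A\<^esub> (y \<ominus>\<^bsub>free_G A\<^esub> ?y) \<oplus>\<^bsub>free_G A\<^esub> y"
      using y by (simp add: a_minus_def eA.A.add.inv_mult_group eA.A.add.m_assoc)
    then have "KA +>\<^bsub>free_G A\<^esub> ?y =
        (KA +>\<^bsub>free_G A\<^esub> \<ominus>\<^bsub>free_G A\<^esub> (y \<ominus>\<^bsub>free_G A\<^esub> ?y)) \<oplus>\<^bsub>free_G A Quot KA\<^esub> (KA +>\<^bsub>free_G A\<^esub> y)"
      using y by (metis KA.quot_add eA.A.add.inv_closed eA.A.minus_closed G.add.hom_closed
          g.add.hom_closed)
    ultimately show "\<exists>s\<in>skb_annihilator (free_G A Quot KA).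
        KA +>\<^bsub>free_G A\<^esub> ?y = s \<oplus>\<^bsub>free_G A Quot KA\<^esub> (KA +>\<^bsub>free_G A\<^esub> y)"
      by blast
  qed

  \<comment> \<open>Both lifts, r of x and below s of h x, exist because the surjective counit
    carries commutator ideals onto commutator ideals.\<close>
  have "counit A ` derived_ideal (free_G A) = derived_ideal A"
    by (rule eA.commutator_image_eq) (simp_all add: A.counit_surj)
  then obtain r where r: "r \<in> derived_ideal (free_G A)" "counit A r = x"
    using x(1) by (metis imageE)
  have rF: "r \<in> carrier (free_G A)"
    using r(1) skew_brace_ideal.sub_carrier [OF eA.A.derived_skew_brace_ideal] by blast
  have SB_img: "counit B ` SB = lower_central B n"
  proof
    show "lower_central B n \<subseteq> counit B ` SB"
    proof
      fix b assume "b \<in> lower_central B n"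
      moreover from this obtain y where "y \<in> carrier (free_G B)" "b = counit B y"
        using B.lower_central_sub B.counit_surj by (metis imageE subsetD)
      ultimately show "b \<in> counit B ` SB" unfolding SB_def by blast
    qed
    show "counit B ` SB \<subseteq> lower_central B n" unfolding SB_def by blast
  qed
  have "counit B ` KB = lower_central B (Suc n)"
    unfolding KB_def lower_central.simps
    using SB.sub_carrier by (intro eB.commutator_image_eq SB_img B.counit_surj) auto
  then obtain s where s: "s \<in> KB" "counit B s = h x"
    using x(2) by (metis imageE)
  have sF: "s \<in> carrier (free_G B)" by (rule KB.sub_carrier [OF s(1)])
  let ?DB = "derived_ideal (free_G B)"
  interpret DB: skew_brace_ideal ?DB "free_G B" by (rule eB.A.derived_skew_brace_ideal)
  have "KB \<subseteq> ?DB"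
    unfolding KB_def using SB.sub_carrier by (intro eB.A.commutator_mono) auto
  then have sD: "s \<in> ?DB" using s(1) by blast
  define z where "z = free_G_map B h r \<ominus>\<^bsub>free_G B\<^esub> s"
  have zF: "z \<in> carrier (free_G B)" using rF sF by (simp add: z_def)
  have "z \<in> ?DB"
    using G.derived_ideal_hom [OF r(1)] sD by (simp add: z_def a_minus_def)
  moreover have "counit B z = \<zero>\<^bsub>B\<^esub>"
    using rF sF r(2) s(2) eB.add.hom_closed [OF sF] by (simp add: z_def eB.hom_minus counit_natural) (simp add: a_minus_def)
  ultimately obtain t where t: "t \<in> derived_ideal (free_G A)" "counit A t = \<zero>\<^bsub>A\<^esub>"
    and tz: "commutator_Ab {z \<in> carrier (free_G B). counit B z = \<zero>\<^bsub>B\<^esub>} (free_G B) +>\<^bsub>free_G B\<^esub>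
      free_G_map B h t =
     commutator_Ab {z \<in> carrier (free_G B). counit B z = \<zero>\<^bsub>B\<^esub>} (free_G B) +>\<^bsub>free_G B\<^esub> z"
    by (rule homology2_lift [OF H2])
  have tF: "t \<in> carrier (free_G A)"
    using t(1) skew_brace_ideal.sub_carrier [OF eA.A.derived_skew_brace_ideal] by blast
  have R: "skew_brace_ideal {z \<in> carrier (free_G B). counit B z = \<zero>\<^bsub>B\<^esub>} (free_G B)"
    using eB.A.skew_brace_idealI eB.vimage_ideal [OF B.zero_ideal] by simp
  \<comment> \<open>The kernel of the counit lies in \<open>SB\<close>, since 0 is in B^n; so the
    congruence obtained from H_2 also holds modulo \<open>KB\<close>.\<close>
  have "commutator_Ab {z \<in> carrier (free_G B). counit B z = \<zero>\<^bsub>B\<^esub>} (free_G B) \<subseteq> KB"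
    unfolding KB_def SB_def by (rule eB.A.commutator_mono) auto
  moreover have "z \<ominus>\<^bsub>free_G B\<^esub> free_G_map B h t \<in>
      commutator_Ab {z \<in> carrier (free_G B). counit B z = \<zero>\<^bsub>B\<^esub>} (free_G B)"
    using tz skew_brace_ideal.coset_eq_iff_minus [OF eB.A.skew_brace_idealI [OF
        skew_brace_ideal.commutator_ideal [OF R]], of "free_G_map B h t" z] tF zF by simp
  ultimately have "z \<ominus>\<^bsub>free_G B\<^esub> free_G_map B h t \<in> KB" by blast
  then have "g (z \<ominus>\<^bsub>free_G B\<^esub> free_G_map B h t) \<in> KA" using gK by blast
  then have "KA +>\<^bsub>free_G A\<^esub> g (free_G_map B h t) = KA +>\<^bsub>free_G A\<^esub> g z"
    using KA.coset_eq_iff_minus tF zF by (simp add: g.hom_minus)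
  also have "\<dots> = KA +>\<^bsub>free_G A\<^esub> g (free_G_map B h r)"
  proof -
    \<comment> \<open>This difference is the conjugate of s by G(h) r, so it lies in the normal
      subgroup \<open>KB\<close>.\<close>
    have "free_G_map B h r \<ominus>\<^bsub>free_G B\<^esub> z = (free_G_map B h r \<oplus>\<^bsub>free_G B\<^esub> s)
        \<ominus>\<^bsub>free_G B\<^esub> free_G_map B h r"
      using rF sF by (simp add: z_def a_minus_def eB.A.add.inv_mult_group eB.A.add.m_assoc)
    moreover have "\<dots> \<in> KB"
      using KB.I.inv_op_closed2 [of "free_G_map B h r" s] s(1) rF by (simp add: a_minus_def)
    ultimately have "g (free_G_map B h r \<ominus>\<^bsub>free_G B\<^esub> z) \<in> KA" using gK by auto
    then show ?thesis
      using KA.coset_eq_iff_minus rF zF by (simp add: g.hom_minus)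
  qed
  finally have "KA +>\<^bsub>free_G A\<^esub> t = KA +>\<^bsub>free_G A\<^esub> r"
    unfolding agree [OF t(1)] agree [OF r(1)] .
  \<comment> \<open>Since \<epsilon> t = 0, the counit sends l to x, and it maps \<open>KA\<close>
    into A^(n+1).\<close>
  then obtain l where l: "l \<in> KA" "r = l \<oplus>\<^bsub>free_G A\<^esub> t"
    using KA.coset_eq_iff [OF tF rF] by blast
  have "x = counit A l"
    using l r(2) t(2) tF KA.sub_carrier [OF l(1)] by auto
  also have "\<dots> \<in> lower_central A (Suc n)"
  proof -
    have "counit A ` SA \<subseteq> lower_central A n" unfolding SA_def by blast
    then have "counit A ` KA \<subseteq> commutator_Ab (lower_central A n) A"
      unfolding KA_def using SA.sub_carrier A.lower_central_sub
      by (intro eA.commutator_image) auto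
    then show ?thesis using l(1) by auto
  qed
  finally show ?thesis .
qed

text \<open>Level 0 is trivial and level 1 is \<open>homology1_injective\<close>. Beyond that,
  \<open>lower_central_lift\<close> and the induction hypothesis provide the bijectivity that the
  step requires.\<close>

lemma lower_central_injective:
  assumes H1: "homology1_map B h \<in> iso (homology1 A) (homology1 B)"
    and H2: "homology2_map B h ` carrier (homology2 A) = carrier (homology2 B)"
    and "x \<in> carrier A" "h x \<in> lower_central B n"
  shows "x \<in> lower_central A n"
  using assms(3,4)
proof (induction n arbitrary: x)
  case 0
  then show ?case by simp
next
  case (Suc n)
  show ?case
  proof (cases n)
    case 0
    then show ?thesis using homology1_injective [OF H1] Suc.prems by simp
  next
    case (Suc m)
    \<comment> \<open>Descending to B^1 = [B, B] lets injectivity on H_1 place x in [A, A], a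
      premise of the step.\<close>
    have "h x \<in> lower_central B (Suc 0)"
      using lift_Suc_antimono_le [of "lower_central B" "Suc 0" "Suc n"] B.lower_central_Suc_sub
        Suc.prems by blast
    then have "x \<in> derived_ideal A" using homology1_injective [OF H1] Suc.prems by simp
    then show ?thesis
      using lower_central_lift [OF homology1_surjective [OF H1]] Suc.IH Suc.prems
      by (intro lower_central_injective_step [OF H2]) blast+
  qed
qed

end

section \<open>Passage to the quotients by the lower central terms\<close>

theorem corollary6p2:
  fixes A :: "'a ring" and B :: "'b ring" and f :: "'a \<Rightarrow> 'b" and n :: nat
  assumes "skew_brace A" and "skew_brace B"
    and "f \<in> skb_hom A B"
    and "homology1_map B f \<in> iso (homology1 A) (homology1 B)"
    and "homology2_map B f ` carrier (homology2 A) = carrier (homology2 B)"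
    and "n \<ge> 1"
  shows "lower_central_quot_map B n f
           \<in> skb_iso (lower_central_quot A n) (lower_central_quot B n)"
proof -
  interpret f: skb_morphism A B f
    using assms(1-3) by (simp add: skb_morphism_def skb_morphism_axioms_def)
  interpret I: skew_brace_ideal "lower_central A n" A
    by (rule f.A.skew_brace_idealI [OF f.A.lower_central_ideal])
  interpret J: skew_brace_ideal "lower_central B n" B
    by (rule f.B.skew_brace_idealI [OF f.B.lower_central_ideal])
  note ideals = f.A.lower_central_ideal f.B.lower_central_ideal f.lower_central_image
  let ?k = "coset_map (add_monoid B) (lower_central B n) f"
  have k: "?k (lower_central A n +>\<^bsub>A\<^esub> x) = lower_central B n +>\<^bsub>B\<^esub> f x" if "x \<in> carrier A" for x
    by (rule f.coset_map_coset [OF ideals that])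
  have "inj_on ?k (carrier (A Quot lower_central A n))"
  proof (rule inj_onI)
    fix X Y assume "X \<in> carrier (A Quot lower_central A n)" "Y \<in> carrier (A Quot lower_central A n)"
      and eq: "?k X = ?k Y"
    then obtain x y where x: "x \<in> carrier A" "X = lower_central A n +>\<^bsub>A\<^esub> x"
      and y: "y \<in> carrier A" "Y = lower_central A n +>\<^bsub>A\<^esub> y"
      by (auto simp: I.quot_carrier)
    \<comment> \<open>Equality of cosets is turned into membership of a difference, the form in
      which injectivity was proved.\<close>
    have "f (y \<ominus>\<^bsub>A\<^esub> x) \<in> lower_central B n"
      using eq x y J.coset_eq_iff_minus [of "f x" "f y"] by (simp add: k f.hom_minus)
    then have "y \<ominus>\<^bsub>A\<^esub> x \<in> lower_central A n"
      using x y by (intro f.lower_central_injective [OF assms(4,5)]) simp_all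
    then show "X = Y" using x y I.coset_eq_iff_minus by simp
  qed
  moreover have "?k ` carrier (A Quot lower_central A n) = carrier (B Quot lower_central B n)"
  proof -
    have "\<exists>a\<in>carrier A. lower_central B n +>\<^bsub>B\<^esub> b = lower_central B n +>\<^bsub>B\<^esub> f a"
      if "b \<in> carrier B" for b
      using f.lower_central_lift [OF f.homology1_surjective [OF assms(4)]] that by blast
    then have "(\<lambda>x. lower_central B n +>\<^bsub>B\<^esub> f x) ` carrier A =
        (\<lambda>x. lower_central B n +>\<^bsub>B\<^esub> x) ` carrier B"
      using f.Pi by blast
    then show ?thesis
      by (simp add: I.quot_carrier J.quot_carrier image_image k cong: image_cong)
  qed
  moreover have "?k \<in> skb_hom (A Quot lower_central A n) (B Quot lower_central B n)"
    by (rule skb_morphism.hom [OF f.quot_morphism [OF ideals]])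
  ultimately show ?thesis
    by (simp add: lower_central_quot_map_def lower_central_quot_def skb_iso_def bij_betw_def)
qed

end
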